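(* Consider instances of the optimal contract problem with matching-based rewards and additive costs on a bipartite graph $G=(V\cup U,A)$ with $n$ vertices, where the edge rewards $(f_e)_{e\in A}$ and the edge costs $(c_e)_{e\in A}$ are integral, $f,c\in\mathbb{Z}^{|A|}$, and where $C=\max_{e\in A}c_e$ and $F=\max_{e\in A}f_e$ are both polynomial in $n$. Then the optimal contract can be computed efficiently, i.e. in time polynomial in $n$.
   Context: Matching-based rewards and additive costs: $G=(V\cup U,A)$ is a bipartite graph whose edges $e\in A$ carry a reward $f_e\ge0$ and a cost $c_e\ge0$; the actions are the edges. For $S\subseteq A$, the reward $f(S)$ is the maximum of $\sum_{e\in M}f_e$ over matchings $M\subseteq S$, and the cost is $c(S)=\sum_{e\in S}c_e$. A contract is $\alpha\in[0,1]$; the agent's utility is $u_a(\alpha,S)=\alpha f(S)-c(S)$ and the principal's utility is $u_p(\alpha,S)=(1-\alpha)f(S)$. The agent's best response $S_\alpha$ maximizes $u_a(\alpha,\cdot)$ over all $S\subseteq A$, with ties broken in favor of sets with larger $f$ and remaining ties broken by a consistent rule independent of $\alpha$. An optimal contract is an $\alpha\in[0,1]$ maximizing $(1-\alpha)f(S_\alpha)$. Normalization: in the general model one requires $f(S)\in[0,1]$; here rewards and costs are integers before a common scaling of $f$ and $c$ that achieves this normalization (such scaling does not affect best responses or which contracts are optimal). *)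

theory Defs
  imports
    Complex_Main
    "HOL-Library.Log_Nat"
    "HOL-Computational_Algebra.Polynomial"
begin

section \<open>Matching-based contracts with additive costs\<close>

text \<open>
  An edge of a bipartite graph on \<open>V \<union> U\<close> is represented by the pair of its endpoint in \<open>V\<close> and its
  endpoint in \<open>U\<close>.
\<close>

definition bipartite_graph :: "'v set \<Rightarrow> 'v set \<Rightarrow> ('v \<times> 'v) set \<Rightarrow> bool" where
  "bipartite_graph V U A \<longleftrightarrow> finite V \<and> finite U \<and> V \<inter> U = {} \<and> A \<subseteq> V \<times> U"

definition matching :: "('v \<times> 'v) set \<Rightarrow> bool" where
  "matching M \<longleftrightarrow> pairwise (\<lambda>e e'. disjnt {fst e, snd e} {fst e', snd e'}) M"

definition reward :: "('v \<times> 'v \<Rightarrow> real) \<Rightarrow> ('v \<times> 'v) set \<Rightarrow> real" where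
  "reward f S = Max {sum f M |M. M \<subseteq> S \<and> matching M}"

definition cost :: "('v \<times> 'v \<Rightarrow> real) \<Rightarrow> ('v \<times> 'v) set \<Rightarrow> real" where
  "cost c S = sum c S"

definition agent_utility ::
  "('v \<times> 'v \<Rightarrow> real) \<Rightarrow> ('v \<times> 'v \<Rightarrow> real) \<Rightarrow> real \<Rightarrow> ('v \<times> 'v) set \<Rightarrow> real" where
  "agent_utility f c \<alpha> S = \<alpha> * reward f S - cost c S"

definition principal_utility ::
  "('v \<times> 'v \<Rightarrow> real) \<Rightarrow> real \<Rightarrow> ('v \<times> 'v) set \<Rightarrow> real" where
  "principal_utility f \<alpha> S = (1 - \<alpha>) * reward f S"

definition utility_maximizers ::
  "('v \<times> 'v) set \<Rightarrow> ('v \<times> 'v \<Rightarrow> real) \<Rightarrow> ('v \<times> 'v \<Rightarrow> real) \<Rightarrow> real \<Rightarrow> ('v \<times> 'v) set set" where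
  "utility_maximizers A f c \<alpha> = {S. is_arg_max (agent_utility f c \<alpha>) (\<lambda>T. T \<subseteq> A) S}"

definition favoured_maximizers ::
  "('v \<times> 'v) set \<Rightarrow> ('v \<times> 'v \<Rightarrow> real) \<Rightarrow> ('v \<times> 'v \<Rightarrow> real) \<Rightarrow> real \<Rightarrow> ('v \<times> 'v) set set" where
  "favoured_maximizers A f c \<alpha> =
     {S. is_arg_max (reward f) (\<lambda>T. T \<in> utility_maximizers A f c \<alpha>) S}"

text \<open>
  The remaining ties are broken by a function that picks one of the tied sets.  It sees only the
  collection of tied sets, and so cannot depend on \<open>\<alpha>\<close> in any other way.
\<close>

definition tie_breaking :: "('v set set \<Rightarrow> 'v set) \<Rightarrow> bool" where
  "tie_breaking \<tau> \<longleftrightarrow> (\<forall>X. X \<noteq> {} \<longrightarrow> \<tau> X \<in> X)"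

definition best_response ::
  "(('v \<times> 'v) set set \<Rightarrow> ('v \<times> 'v) set) \<Rightarrow> ('v \<times> 'v) set \<Rightarrow>
   ('v \<times> 'v \<Rightarrow> real) \<Rightarrow> ('v \<times> 'v \<Rightarrow> real) \<Rightarrow> real \<Rightarrow> ('v \<times> 'v) set" where
  "best_response \<tau> A f c \<alpha> = \<tau> (favoured_maximizers A f c \<alpha>)"

definition optimal_contract ::
  "(('v \<times> 'v) set set \<Rightarrow> ('v \<times> 'v) set) \<Rightarrow> ('v \<times> 'v) set \<Rightarrow>
   ('v \<times> 'v \<Rightarrow> real) \<Rightarrow> ('v \<times> 'v \<Rightarrow> real) \<Rightarrow> real \<Rightarrow> bool" where
  "optimal_contract \<tau> A f c \<alpha> \<longleftrightarrow>
     is_arg_max (\<lambda>\<beta>. principal_utility f \<beta> (best_response \<tau> A f c \<beta>)) (\<lambda>\<beta>. \<beta> \<in> {0..1}) \<alpha>"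

text \<open>The numbers \<open>F\<close> and \<open>C\<close>; including \<open>0\<close> only matters for the graph without edges.\<close>

definition max_entry :: "'e set \<Rightarrow> ('e \<Rightarrow> nat) \<Rightarrow> nat" where
  "max_entry A w = Max (insert 0 (w ` A))"


section \<open>Random-access programs with logarithmic cost\<close>

text \<open>
  Running time is measured on a random-access machine, presented as a while language.  A program
  mentions finitely many integer variables and finitely many unbounded integer arrays.  The cost is
  logarithmic: every value that an expression produces, including intermediate results and array
  indices, is charged one plus its length in binary.  Up to a polynomial, this is running time on a
  Turing machine.
\<close>

type_synonym vname = string

record state =
  var :: "vname \<Rightarrow> int"
  arr :: "vname \<Rightarrow> int \<Rightarrow> int"

datatype aexp =
    Lit int
  | Var vname
  | Elem vname aexp
  | Add aexp aexp
  | Sub aexp aexp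
  | Mul aexp aexp

datatype bexp =
    Less aexp aexp
  | Neg bexp
  | Conj bexp bexp

datatype com =
    Skip
  | Assign vname aexp
  | Store vname aexp aexp
  | Seq com com
  | Cond bexp com com
  | While bexp com

fun aval :: "aexp \<Rightarrow> state \<Rightarrow> int" where
  "aval (Lit k) s = k"
| "aval (Var x) s = var s x"
| "aval (Elem a i) s = arr s a (aval i s)"
| "aval (Add a b) s = aval a s + aval b s"
| "aval (Sub a b) s = aval a s - aval b s"
| "aval (Mul a b) s = aval a s * aval b s"

fun bval :: "bexp \<Rightarrow> state \<Rightarrow> bool" where
  "bval (Less a b) s \<longleftrightarrow> aval a s < aval b s"
| "bval (Neg b) s \<longleftrightarrow> \<not> bval b s"
| "bval (Conj b b') s \<longleftrightarrow> bval b s \<and> bval b' s"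

definition charge :: "int \<Rightarrow> nat" where
  "charge k = 1 + floorlog 2 (nat \<bar>k\<bar>)"

fun atime :: "aexp \<Rightarrow> state \<Rightarrow> nat" where
  "atime (Lit k) s = charge k"
| "atime (Var x) s = charge (var s x)"
| "atime (Elem a i) s = atime i s + charge (aval (Elem a i) s)"
| "atime (Add a b) s = atime a s + atime b s + charge (aval (Add a b) s)"
| "atime (Sub a b) s = atime a s + atime b s + charge (aval (Sub a b) s)"
| "atime (Mul a b) s = atime a s + atime b s + charge (aval (Mul a b) s)"

fun btime :: "bexp \<Rightarrow> state \<Rightarrow> nat" where
  "btime (Less a b) s = 1 + atime a s + atime b s"
| "btime (Neg b) s = 1 + btime b s"
| "btime (Conj b b') s = 1 + btime b s + btime b' s"

text \<open>\<open>exec P s t s'\<close>: started in \<open>s\<close>, the program \<open>P\<close> terminates in \<open>s'\<close> after time \<open>t\<close>.\<close>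

inductive exec :: "com \<Rightarrow> state \<Rightarrow> nat \<Rightarrow> state \<Rightarrow> bool" where
  Skip: "exec Skip s 1 s"
| Assign: "exec (Assign x a) s (1 + atime a s) (s\<lparr>var := (var s)(x := aval a s)\<rparr>)"
| Store: "exec (Store y i a) s (1 + atime i s + atime a s)
            (s\<lparr>arr := (arr s)(y := (arr s y)(aval i s := aval a s))\<rparr>)"
| Seq: "exec P s t s' \<Longrightarrow> exec Q s' t' s'' \<Longrightarrow> exec (Seq P Q) s (t + t') s''"
| CondTrue: "bval b s \<Longrightarrow> exec P s t s' \<Longrightarrow> exec (Cond b P Q) s (1 + btime b s + t) s'"
| CondFalse: "\<not> bval b s \<Longrightarrow> exec Q s t s' \<Longrightarrow> exec (Cond b P Q) s (1 + btime b s + t) s'"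
| WhileFalse: "\<not> bval b s \<Longrightarrow> exec (While b P) s (1 + btime b s) s"
| WhileTrue: "bval b s \<Longrightarrow> exec P s t s' \<Longrightarrow> exec (While b P) s' t' s'' \<Longrightarrow>
                exec (While b P) s (1 + btime b s + t + t') s''"

lemma exec_deterministic:
  "exec P s t s' \<Longrightarrow> exec P s u s'' \<Longrightarrow> u = t \<and> s'' = s'"
proof (induction arbitrary: u s'' rule: exec.induct)
  case Skip
  then show ?case by (auto elim: exec.cases)
next
  case Assign
  then show ?case by (auto elim: exec.cases)
next
  case Store
  then show ?case by (auto elim: exec.cases)
next
  case (Seq P s t s' Q t' s2)
  from Seq.prems show ?case by (cases rule: exec.cases) (use Seq.IH in blast)+
next
  case (CondTrue b s P t s' Q)
  from CondTrue.prems show ?case by (cases rule: exec.cases) (use CondTrue in blast)+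
next
  case (CondFalse b s Q t s' P)
  from CondFalse.prems show ?case by (cases rule: exec.cases) (use CondFalse in blast)+
next
  case (WhileFalse b s P)
  from WhileFalse.prems show ?case by (cases rule: exec.cases) (use WhileFalse in blast)+
next
  case (WhileTrue b s P t s' t' s2)
  from WhileTrue.prems show ?case by (cases rule: exec.cases) (use WhileTrue in blast)+
qed


section \<open>Input and output\<close>

text \<open>
  An instance on the vertices \<open>0, \<dots>, n - 1\<close> is given to a program as an edge list in any order: entry
  \<open>i\<close> of the four arrays holds the two endpoints, the reward and the cost of edge \<open>i\<close>.
\<close>

definition table :: "nat list \<Rightarrow> int \<Rightarrow> int" where
  "table xs i = (if 0 \<le> i \<and> nat i < length xs then int (xs ! nat i) else 0)"

definition input_state ::
  "nat \<Rightarrow> (nat \<times> nat) list \<Rightarrow> (nat \<times> nat \<Rightarrow> nat) \<Rightarrow> (nat \<times> nat \<Rightarrow> nat) \<Rightarrow> state" where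
  "input_state n es f c =
     \<lparr>var = (\<lambda>_. 0)(''vertices'' := int n, ''edges'' := int (length es)),
      arr = (\<lambda>_ _. 0)(''left'' := table (map fst es), ''right'' := table (map snd es),
                      ''reward'' := table (map f es), ''cost'' := table (map c es))\<rparr>"

text \<open>The computed contract is a rational number, returned as a fraction.\<close>

definition output_contract :: "state \<Rightarrow> real" where
  "output_contract s = of_int (var s ''numerator'') / of_int (var s ''denominator'')"

end

theory Submission
  imports Defs
begin

text \<open>
  A best response has the reward of a matching that maximizes \<open>\<alpha> f(M) - c(M)\<close> and, among those, \<open>f(M)\<close>.
  Lowering \<open>\<alpha>\<close> until that matching is about to lose its optimality only helps the principal, so some
  optimal contract is a fraction \<open>a / b\<close> with \<open>a \<le> b \<le> N + 1\<close>, where \<open>N\<close> is the sum of all rewards.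
  There are polynomially many such fractions.  For each of them the matching is found by a
  primal-dual auction with unit price increments on the integral weights
  \<open>(m + 1) ((a f - b c) (N + 1) + f)\<close>, where \<open>m\<close> is the number of edges: the factor \<open>N + 1\<close> makes \<open>f\<close> a
  secondary criterion, the factor \<open>m + 1\<close> absorbs the error of the auction.  All weights are
  polynomially bounded, and hence so is the number of price changes.
\<close>

section \<open>Programs with polynomially bounded values\<close>

text \<open>The agent may choose any edge set, and the reward of a set is not additive. Thinning a
  set to a matching that attains its reward only saves cost, so best responses can be studied on
  matchings, where reward and cost are plain sums. As ties favour larger rewards, the sets left to
  \<open>\<tau>\<close> all have the same reward, and every admissible \<open>\<tau>\<close> yields
  the same principal's utility.

  The obstacle on the machine side is running time: every value is charged, and one program must
  serve all polynomials p. Time is therefore not counted along a run. If all stored values stay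
  within B and every loop counts up to a stored variable, no loop makes more than B iterations, and
  a polynomial in B read off the program text bounds the time. It remains to bound values. This is
  why the auction runs for a number of rounds fixed in advance instead of until it settles: the sum
  of the right duals minus the sum of the left duals gains one in every unsettled round, and its
  range tells how many rounds suffice.\<close>

definition bounded_state :: "nat \<Rightarrow> state \<Rightarrow> bool" where
  "bounded_state B s \<longleftrightarrow> (\<forall>x. \<bar>var s x\<bar> \<le> int B) \<and> (\<forall>y i. \<bar>arr s y i\<bar> \<le> int B)"

lemma bounded_state_var: "bounded_state B s \<Longrightarrow> \<bar>var s x\<bar> \<le> int B"
  by (simp add: bounded_state_def)

text \<open>Only stored values have to stay within B; an intermediate result may be larger and is
  bounded by a polynomial in B. Array reads need no analysis of the index because
  \<open>bounded_state\<close> covers every cell.\<close>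

fun value_bound :: "aexp \<Rightarrow> nat poly" where
  "value_bound (Lit k) = [:nat \<bar>k\<bar>:]"
| "value_bound (Var x) = [:0, 1:]"
| "value_bound (Elem y i) = [:0, 1:]"
| "value_bound (Add a b) = value_bound a + value_bound b"
| "value_bound (Sub a b) = value_bound a + value_bound b"
| "value_bound (Mul a b) = value_bound a * value_bound b"

fun aexp_time :: "aexp \<Rightarrow> nat poly" where
  "aexp_time (Lit k) = 1 + value_bound (Lit k)"
| "aexp_time (Var x) = 1 + value_bound (Var x)"
| "aexp_time (Elem y i) = aexp_time i + (1 + value_bound (Elem y i))"
| "aexp_time (Add a b) = aexp_time a + aexp_time b + (1 + value_bound (Add a b))"
| "aexp_time (Sub a b) = aexp_time a + aexp_time b + (1 + value_bound (Sub a b))"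
| "aexp_time (Mul a b) = aexp_time a + aexp_time b + (1 + value_bound (Mul a b))"

fun bexp_time :: "bexp \<Rightarrow> nat poly" where
  "bexp_time (Less a b) = 1 + aexp_time a + aexp_time b"
| "bexp_time (Neg b) = 1 + bexp_time b"
| "bexp_time (Conj b b') = 1 + bexp_time b + bexp_time b'"

text \<open>The clause for \<open>While\<close> is meant for loops that make at most as many iterations as the bound on the
  values allows.\<close>

fun com_time :: "com \<Rightarrow> nat poly" where
  "com_time Skip = 1"
| "com_time (Assign x a) = 1 + aexp_time a"
| "com_time (Store y i a) = 1 + aexp_time i + aexp_time a"
| "com_time (Seq P Q) = com_time P + com_time Q"
| "com_time (Cond b P Q) = 1 + bexp_time b + com_time P + com_time Q"
| "com_time (While b P) = [:1, 1:] * (1 + bexp_time b + com_time P)"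

text \<open>Bounding the binary length by the value itself is exponentially wasteful, but harmless
  where all values are polynomial in the instance size.\<close>

lemma charge_le: "charge k \<le> 1 + nat \<bar>k\<bar>"
proof -
  have "floorlog 2 x \<le> x" for x :: nat
  proof (cases "x = 0")
    case False
    have "x < 2 ^ x" by simp
    then show ?thesis using False by (simp add: floorlog_le_iff)
  qed (simp add: floorlog_def)
  then show ?thesis by (simp add: charge_def)
qed

lemma abs_aval_le:
  assumes "bounded_state B s"
  shows "\<bar>aval a s\<bar> \<le> int (poly (value_bound a) B)"
proof (induction a)
  case (Mul a b)
  then show ?case by (simp add: abs_mult mult_mono)
qed (use assms in \<open>auto simp: bounded_state_def\<close>)

lemma charge_aval_le:
  assumes "bounded_state B s"
  shows "charge (aval a s) \<le> 1 + poly (value_bound a) B"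
  using charge_le[of "aval a s"] abs_aval_le[OF assms, of a] by linarith

lemma atime_le: "bounded_state B s \<Longrightarrow> atime a s \<le> poly (aexp_time a) B"
proof (induction a)
  case (Lit k)
  then show ?case using charge_aval_le[OF Lit, of "Lit k"] by simp
next
  case (Var x)
  then show ?case using charge_aval_le[OF Var, of "Var x"] by simp
next
  case (Elem y i)
  then show ?case using charge_aval_le[OF Elem.prems, of "Elem y i"] by simp
next
  case (Add a b)
  then show ?case using charge_aval_le[OF Add.prems, of "Add a b"] by simp
next
  case (Sub a b)
  then show ?case using charge_aval_le[OF Sub.prems, of "Sub a b"] by simp
next
  case (Mul a b)
  then show ?case using charge_aval_le[OF Mul.prems, of "Mul a b"] by simp
qed

lemma btime_le: "bounded_state B s \<Longrightarrow> btime b s \<le> poly (bexp_time b) B"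
proof (induction b)
  case (Less a b)
  then show ?case using atime_le[OF Less, of a] atime_le[OF Less, of b] by simp
qed auto

text \<open>A total-correctness triple whose time bound depends on the program text and B alone.
  Boundedness is a premise and is re-established at the end, so the rules below ask for it only at
  assignments and stores.\<close>

definition computes :: "nat \<Rightarrow> com \<Rightarrow> state \<Rightarrow> (state \<Rightarrow> bool) \<Rightarrow> bool" where
  "computes B P s Q \<longleftrightarrow> (bounded_state B s \<longrightarrow>
     (\<exists>t s'. exec P s t s' \<and> t \<le> poly (com_time P) B \<and> bounded_state B s' \<and> Q s'))"

lemma computes_Skip: "Q s \<Longrightarrow> computes B Skip s Q"
  unfolding computes_def using exec.Skip by fastforce

lemma computes_Assign:
  assumes "bounded_state B s \<Longrightarrow> \<bar>aval a s\<bar> \<le> int B"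
    and "Q (s\<lparr>var := (var s)(x := aval a s)\<rparr>)"
  shows "computes B (Assign x a) s Q"
  unfolding computes_def
proof
  assume b: "bounded_state B s"
  have "bounded_state B (s\<lparr>var := (var s)(x := aval a s)\<rparr>)"
    using b assms(1) by (auto simp: bounded_state_def)
  then show "\<exists>t s'. exec (Assign x a) s t s' \<and> t \<le> poly (com_time (Assign x a)) B \<and>
      bounded_state B s' \<and> Q s'"
    using exec.Assign[of x a s] atime_le[OF b, of a] assms(2) by fastforce
qed

lemma computes_Store:
  assumes "bounded_state B s \<Longrightarrow> \<bar>aval a s\<bar> \<le> int B"
    and "Q (s\<lparr>arr := (arr s)(y := (arr s y)(aval i s := aval a s))\<rparr>)"
  shows "computes B (Store y i a) s Q"
  unfolding computes_def
proof
  assume b: "bounded_state B s"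
  have "bounded_state B (s\<lparr>arr := (arr s)(y := (arr s y)(aval i s := aval a s))\<rparr>)"
    using b assms(1) by (auto simp: bounded_state_def)
  then show "\<exists>t s'. exec (Store y i a) s t s' \<and> t \<le> poly (com_time (Store y i a)) B \<and>
      bounded_state B s' \<and> Q s'"
    using exec.Store[of y i a s] atime_le[OF b, of a] atime_le[OF b, of i] assms(2) by fastforce
qed

text \<open>Naming the new state keeps goals about straight-line code small: a nested update mentions the old
  state several times.\<close>

lemma computes_Assign_fresh:
  assumes "bounded_state B s \<Longrightarrow> \<bar>aval a s\<bar> \<le> int B"
    and "\<And>s'. var s' = (var s)(x := aval a s) \<Longrightarrow> arr s' = arr s \<Longrightarrow> Q s'"
  shows "computes B (Assign x a) s Q"
  by (rule computes_Assign[OF assms]) simp_all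

lemma computes_Store_fresh:
  assumes "bounded_state B s \<Longrightarrow> \<bar>aval a s\<bar> \<le> int B"
    and "\<And>s'. var s' = var s \<Longrightarrow> arr s' = (arr s)(y := (arr s y)(aval i s := aval a s)) \<Longrightarrow> Q s'"
  shows "computes B (Store y i a) s Q"
  by (rule computes_Store[OF assms]) simp_all

lemma computes_Seq:
  assumes "computes B P s (\<lambda>s'. computes B P' s' Q)"
  shows "computes B (Seq P P') s Q"
  unfolding computes_def
proof
  assume "bounded_state B s"
  then obtain t s' t' s'' where "exec P s t s'" "t \<le> poly (com_time P) B"
    "exec P' s' t' s''" "t' \<le> poly (com_time P') B" "bounded_state B s''" "Q s''"
    using assms unfolding computes_def by blast
  then show "\<exists>t s'. exec (Seq P P') s t s' \<and> t \<le> poly (com_time (Seq P P')) B \<and>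
      bounded_state B s' \<and> Q s'"
    using exec.Seq[of P s t s' P' t' s''] by (intro exI[of _ "t + t'"] exI[of _ s'']) simp
qed

lemma computes_Cond:
  assumes "bval b s \<Longrightarrow> computes B P s Q"
    and "\<not> bval b s \<Longrightarrow> computes B P' s Q"
  shows "computes B (Cond b P P') s Q"
  unfolding computes_def
proof
  assume bs: "bounded_state B s"
  show "\<exists>t s'. exec (Cond b P P') s t s' \<and> t \<le> poly (com_time (Cond b P P')) B \<and>
      bounded_state B s' \<and> Q s'"
  proof (cases "bval b s")
    case True
    then obtain t s' where "exec P s t s'" "t \<le> poly (com_time P) B" "bounded_state B s'" "Q s'"
      using assms bs unfolding computes_def by blast
    then show ?thesis using exec.CondTrue[OF True, of P t s' P'] btime_le[OF bs, of b]
      by (intro exI[of _ "1 + btime b s + t"] exI[of _ s']) simp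
  next
    case False
    then obtain t s' where "exec P' s t s'" "t \<le> poly (com_time P') B" "bounded_state B s'" "Q s'"
      using assms bs unfolding computes_def by blast
    then show ?thesis using exec.CondFalse[OF False, of P' t s' P] btime_le[OF bs, of b]
      by (intro exI[of _ "1 + btime b s + t"] exI[of _ s']) simp
  qed
qed

lemma computes_weaken:
  "computes B P s Q \<Longrightarrow> (\<And>s'. bounded_state B s' \<Longrightarrow> Q s' \<Longrightarrow> Q' s') \<Longrightarrow> computes B P s Q'"
  unfolding computes_def by blast

section \<open>Counting loops\<close>

text \<open>The limit is a variable rather than an expression: its value is then a stored value,
  hence at most B, which justifies the \<open>While\<close> clause of
  \<open>com_time\<close>.\<close>

definition For :: "vname \<Rightarrow> vname \<Rightarrow> com \<Rightarrow> com" where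
  "For x y P = Seq (Assign x (Lit 0))
     (While (Less (Var x) (Var y)) (Seq P (Assign x (Add (Var x) (Lit 1)))))"

text \<open>Induction on the number \<open>N - i\<close> of iterations still to come; the extra
  summand 1 pays for the failing test at the end.\<close>

lemma exec_While_count:
  assumes "bounded_state B s" "I i s" "i \<le> N"
    and counter: "\<And>i s. I i s \<Longrightarrow> var s x = i \<and> var s y = N"
    and body: "\<And>i s. i < N \<Longrightarrow> I i s \<Longrightarrow> bounded_state B s \<Longrightarrow>
      \<exists>t s'. exec P s t s' \<and> t \<le> T \<and> bounded_state B s' \<and> I (i + 1) s'"
  shows "\<exists>t s'. exec (While (Less (Var x) (Var y)) P) s t s' \<and>
    t \<le> (nat (N - i) + 1) * (1 + poly (bexp_time (Less (Var x) (Var y))) B + T) \<and>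
    bounded_state B s' \<and> I N s'"
  using assms(1-3)
proof (induction "nat (N - i)" arbitrary: i s)
  case 0
  then have "i = N" by simp
  with 0 have "\<not> bval (Less (Var x) (Var y)) s" using counter by fastforce
  from exec.WhileFalse[OF this, of P] show ?case
    using 0 \<open>i = N\<close> btime_le[OF 0(2), of "Less (Var x) (Var y)"]
    by (intro exI[of _ "1 + btime (Less (Var x) (Var y)) s"] exI[of _ s]) simp
next
  case (Suc d)
  let ?b = "Less (Var x) (Var y)"
  let ?C = "1 + poly (bexp_time ?b) B + T"
  have "i < N" using Suc.hyps(2) by simp
  then have b: "bval ?b s" using counter[OF Suc.prems(2)] by simp
  obtain t s' where 1: "exec P s t s'" "t \<le> T" "bounded_state B s'" "I (i + 1) s'"
    using body[OF \<open>i < N\<close> Suc.prems(2,1)] by blast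
  have "d = nat (N - (i + 1))" using Suc.hyps(2) by simp
  from Suc.hyps(1)[OF this 1(3,4)] \<open>i < N\<close> obtain t' s'' where
    2: "exec (While ?b P) s' t' s''" "t' \<le> (nat (N - (i + 1)) + 1) * ?C"
       "bounded_state B s''" "I N s''"
    by auto
  have "(nat (N - i) + 1) * ?C = (nat (N - (i + 1)) + 1) * ?C + ?C"
    using \<open>i < N\<close> \<open>d = nat (N - (i + 1))\<close> Suc.hyps(2) by (metis Suc_eq_plus1 add.commute mult_Suc)
  then have "1 + btime ?b s + t + t' \<le> (nat (N - i) + 1) * ?C"
    using 1(2) 2(2) btime_le[OF Suc.prems(1), of ?b] by linarith
  then show ?case using exec.WhileTrue[OF b 1(1) 2(1)] 2(3,4) by blast
qed

lemma computes_For: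
  assumes "I 0 (s\<lparr>var := (var s)(x := 0)\<rparr>)" "0 \<le> N"
    and counter: "\<And>i s. I i s \<Longrightarrow> var s x = i \<and> var s y = N"
    and body: "\<And>i s. 0 \<le> i \<Longrightarrow> i < N \<Longrightarrow> I i s \<Longrightarrow>
      computes B P s (\<lambda>s'. var s' x = i \<and> I (i + 1) (s'\<lparr>var := (var s')(x := i + 1)\<rparr>))"
    and post: "\<And>s'. I N s' \<Longrightarrow> Q s'"
  shows "computes B (For x y P) s Q"
  unfolding For_def
proof (intro computes_Seq computes_Assign)
  let ?s = "s\<lparr>var := (var s)(x := aval (Lit 0) s)\<rparr>"
  let ?P = "Seq P (Assign x (Add (Var x) (Lit 1)))"
  let ?b = "Less (Var x) (Var y)"
  show "computes B (While ?b ?P) ?s Q"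
    unfolding computes_def
  proof
    assume bs: "bounded_state B ?s"
    have "var ?s y = N" using counter[OF assms(1)] by simp
    \<comment> \<open>The limit is held in a variable; this caps the number of iterations as well as
      the incremented counter.\<close>
    then have NB: "N \<le> int B" using bs unfolding bounded_state_def by (metis abs_le_D1)
    let ?J = "\<lambda>i s. 0 \<le> i \<and> I i s"
    have J: "?J 0 ?s" using assms(1) by simp
    have step: "\<exists>t s'. exec ?P s t s' \<and> t \<le> poly (com_time ?P) B \<and> bounded_state B s' \<and> ?J (i + 1) s'"
      if "i < N" "?J i s" "bounded_state B s" for i s
    proof -
      have "computes B ?P s (?J (i + 1))"
        using that NB
        by (intro computes_Seq computes_weaken[OF body[of i s]] computes_Assign) auto
      then show ?thesis using that(3) unfolding computes_def by blast
    qed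
    obtain t s' where *: "exec (While ?b ?P) ?s t s'"
      "t \<le> (nat (N - 0) + 1) * (1 + poly (bexp_time ?b) B + poly (com_time ?P) B)"
      "bounded_state B s'" "?J N s'"
      using exec_While_count[where I = ?J and x = x and y = y, OF bs J assms(2) _ step] counter by blast
    have "t \<le> (B + 1) * (1 + poly (bexp_time ?b) B + poly (com_time ?P) B)"
      by (rule le_trans[OF *(2)], rule mult_right_mono) (use NB in auto)
    also have "\<dots> = poly (com_time (While ?b ?P)) B" by simp
    finally show "\<exists>t s'. exec (While ?b ?P) ?s t s' \<and> t \<le> poly (com_time (While ?b ?P)) B \<and>
        bounded_state B s' \<and> Q s'"
      using * post by blast
  qed
qed simp

section \<open>The auction for a bipartite matching\<close>

text \<open>Edges are the indices below \<open>m\<close>. Both endpoint maps lead into one vertex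
  range, so a single array can hold the data of both sides. Weights may be negative; only an upper
  bound \<open>W\<close> is required.\<close>

locale auction =
  fixes m :: int and L R :: "int \<Rightarrow> int" and w :: "int \<Rightarrow> int" and W :: int
  assumes m_nonneg: "0 \<le> m"
    and bipartite: "\<And>k l. 0 \<le> k \<Longrightarrow> k < m \<Longrightarrow> 0 \<le> l \<Longrightarrow> l < m \<Longrightarrow> L k \<noteq> R l"
    and W_nonneg: "0 \<le> W"
    and w_le: "\<And>k. 0 \<le> k \<Longrightarrow> k < m \<Longrightarrow> w k \<le> W"
begin

abbreviation "E \<equiv> {0..<m}"
abbreviation "X \<equiv> L ` E \<union> R ` E"

text \<open>Complementary slackness with error one for the linear program of maximum weight
  matching. The duals \<open>d\<close> (profits on the left, prices on the right) cover every edge.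
  \<open>\<mu> v\<close> is 0 for a free vertex and otherwise one plus the index of its matched
  edge, whose duals exceed its weight by at most one. A free right vertex has price 0; the analogous
  condition on the left is the goal of the auction, \<open>settled\<close>.\<close>

definition invariant :: "(int \<Rightarrow> int) \<Rightarrow> (int \<Rightarrow> int) \<Rightarrow> bool" where
  "invariant d \<mu> \<longleftrightarrow>
     (\<forall>v\<in>X. 0 \<le> d v \<and> d v \<le> W + 1) \<and>
     (\<forall>k\<in>E. d (L k) \<le> W \<and> w k \<le> d (L k) + d (R k)) \<and>
     (\<forall>k\<in>E. \<mu> (R k) = 0 \<longrightarrow> d (R k) = 0) \<and>
     (\<forall>v\<in>X. 0 \<le> \<mu> v \<and> \<mu> v \<le> m) \<and>
     (\<forall>v\<in>X. 0 < \<mu> v \<longrightarrow> (v = L (\<mu> v - 1) \<or> v = R (\<mu> v - 1)) \<and>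
        \<mu> (L (\<mu> v - 1)) = \<mu> v \<and> \<mu> (R (\<mu> v - 1)) = \<mu> v \<and>
        d (L (\<mu> v - 1)) + d (R (\<mu> v - 1)) \<le> w (\<mu> v - 1) + 1)"

lemma
  assumes "invariant d \<mu>"
  shows invariant_dual: "v \<in> X \<Longrightarrow> 0 \<le> d v" "v \<in> X \<Longrightarrow> d v \<le> W + 1"
    and invariant_edge: "k \<in> E \<Longrightarrow> d (L k) \<le> W" "k \<in> E \<Longrightarrow> w k \<le> d (L k) + d (R k)"
    and invariant_free: "k \<in> E \<Longrightarrow> \<mu> (R k) = 0 \<Longrightarrow> d (R k) = 0"
    and invariant_mate_range: "v \<in> X \<Longrightarrow> 0 \<le> \<mu> v" "v \<in> X \<Longrightarrow> \<mu> v \<le> m"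
    and invariant_mate: "v \<in> X \<Longrightarrow> 0 < \<mu> v \<Longrightarrow> v = L (\<mu> v - 1) \<or> v = R (\<mu> v - 1)"
      "v \<in> X \<Longrightarrow> 0 < \<mu> v \<Longrightarrow> \<mu> (L (\<mu> v - 1)) = \<mu> v"
      "v \<in> X \<Longrightarrow> 0 < \<mu> v \<Longrightarrow> \<mu> (R (\<mu> v - 1)) = \<mu> v"
      "v \<in> X \<Longrightarrow> 0 < \<mu> v \<Longrightarrow> d (L (\<mu> v - 1)) + d (R (\<mu> v - 1)) \<le> w (\<mu> v - 1) + 1"
  using assms unfolding invariant_def by blast+

lemma invariant_mate_edge:
  assumes "invariant d \<mu>" "v \<in> X" "0 < \<mu> v"
  shows "\<mu> v - 1 \<in> E"
  using invariant_mate_range(2)[OF assms(1,2)] assms(3) by simp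

text \<open>Prices only rise and profits only fall, one unit per move, so this difference counts the
  moves made.\<close>

definition potential :: "(int \<Rightarrow> int) \<Rightarrow> int" where
  "potential d = (\<Sum>v\<in>R ` E. d v) - (\<Sum>v\<in>L ` E. d v)"

definition settled :: "(int \<Rightarrow> int) \<Rightarrow> (int \<Rightarrow> int) \<Rightarrow> bool" where
  "settled d \<mu> \<longleftrightarrow> (\<forall>k\<in>E. \<mu> (L k) = 0 \<longrightarrow> d (L k) = 0)"

text \<open>Inspecting the left endpoint suffices, since under the invariant both endpoints of a
  matched edge carry the same entry.\<close>

definition matched :: "(int \<Rightarrow> int) \<Rightarrow> int set" where
  "matched \<mu> = {k\<in>E. \<mu> (L k) = k + 1}"

lemma card_image_E_le: "int (card (g ` E)) \<le> m"
  using card_image_le[of E g] m_nonneg by simp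

section \<open>The moves of the auction\<close>

text \<open>Profits \<open>W\<close> alone cover every edge, so the empty matching with zero prices
  is a feasible start.\<close>

lemma invariant_init:
  assumes "\<And>k. k \<in> E \<Longrightarrow> d (L k) = W \<and> d (R k) = 0 \<and> \<mu> (L k) = 0 \<and> \<mu> (R k) = 0"
  shows "invariant d \<mu>" "potential d \<ge> - m * W"
proof -
  show "invariant d \<mu>"
    unfolding invariant_def using assms w_le W_nonneg m_nonneg by auto
  have "(\<Sum>v\<in>L ` E. d v) \<le> (\<Sum>v\<in>L ` E. W)" by (rule sum_mono) (use assms in auto)
  also have "\<dots> = int (card (L ` E)) * W" by simp
  also have "\<dots> \<le> m * W" by (rule mult_right_mono[OF card_image_E_le W_nonneg])
  finally have "(\<Sum>v\<in>L ` E. d v) \<le> m * W" .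
  moreover have "(\<Sum>v\<in>R ` E. d v) = 0" using assms by (intro sum.neutral) auto
  ultimately show "potential d \<ge> - m * W" by (simp add: potential_def)
qed

lemma potential_le: "invariant d \<mu> \<Longrightarrow> potential d \<le> m * (W + 1)"
proof -
  assume inv: "invariant d \<mu>"
  have "(\<Sum>v\<in>R ` E. d v) \<le> (\<Sum>v\<in>R ` E. W + 1)"
    by (rule sum_mono) (use invariant_dual[OF inv] in blast)
  also have "\<dots> = int (card (R ` E)) * (W + 1)" by simp
  also have "\<dots> \<le> m * (W + 1)" by (rule mult_right_mono[OF card_image_E_le]) (use W_nonneg in simp)
  finally have "(\<Sum>v\<in>R ` E. d v) \<le> m * (W + 1)" .
  moreover have "0 \<le> (\<Sum>v\<in>L ` E. d v)"
    by (rule sum_nonneg) (use invariant_dual[OF inv] in blast)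
  ultimately show ?thesis by (simp add: potential_def)
qed

text \<open>By integrality an edge that is not tight has slack at least one, so the cover survives
  the decrease; and as \<open>L k\<close> is free, no matched edge sees its profit change.\<close>

lemma invariant_lower:
  assumes inv: "invariant d \<mu>" and k: "k \<in> E" "\<mu> (L k) = 0" "0 < d (L k)"
    and loose: "\<And>l. l \<in> E \<Longrightarrow> L l = L k \<Longrightarrow> w l < d (L k) + d (R l)"
  shows "invariant (d(L k := d (L k) - 1)) \<mu>"
    and "potential (d(L k := d (L k) - 1)) = potential d + 1"
proof -
  have ne: "R l \<noteq> L k" if "l \<in> E" for l using bipartite[of k l] k that by auto
  have mate: "L k \<noteq> L (\<mu> v - 1)" if "v \<in> X" "0 < \<mu> v" for v
    using invariant_mate(2)[OF inv that] that k(2) by auto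
  have mate': "\<mu> v - 1 \<in> E" if "v \<in> X" "0 < \<mu> v" for v
    by (rule invariant_mate_edge[OF inv that])
  show "invariant (d(L k := d (L k) - 1)) \<mu>"
    unfolding invariant_def
  proof (intro conjI)
    show "\<forall>v\<in>X. 0 \<le> (d(L k := d (L k) - 1)) v \<and> (d(L k := d (L k) - 1)) v \<le> W + 1"
    proof
      fix v assume "v \<in> X"
      then show "0 \<le> (d(L k := d (L k) - 1)) v \<and> (d(L k := d (L k) - 1)) v \<le> W + 1"
        using invariant_dual[OF inv, of v] k(3) by auto
    qed
    show "\<forall>l\<in>E. (d(L k := d (L k) - 1)) (L l) \<le> W \<and>
        w l \<le> (d(L k := d (L k) - 1)) (L l) + (d(L k := d (L k) - 1)) (R l)"
    proof
      fix l assume l: "l \<in> E"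
      show "(d(L k := d (L k) - 1)) (L l) \<le> W \<and>
        w l \<le> (d(L k := d (L k) - 1)) (L l) + (d(L k := d (L k) - 1)) (R l)"
      proof (cases "L l = L k")
        case True
        then show ?thesis using ne[OF l] loose[OF l] invariant_edge[OF inv k(1)] by simp
      next
        case False
        then show ?thesis using ne[OF l] invariant_edge[OF inv l] by simp
      qed
    qed
    show "\<forall>l\<in>E. \<mu> (R l) = 0 \<longrightarrow> (d(L k := d (L k) - 1)) (R l) = 0"
      using invariant_free[OF inv] ne by simp
    show "\<forall>v\<in>X. 0 \<le> \<mu> v \<and> \<mu> v \<le> m"
      using inv unfolding invariant_def by blast
    show "\<forall>v\<in>X. 0 < \<mu> v \<longrightarrow> (v = L (\<mu> v - 1) \<or> v = R (\<mu> v - 1)) \<and>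
        \<mu> (L (\<mu> v - 1)) = \<mu> v \<and> \<mu> (R (\<mu> v - 1)) = \<mu> v \<and>
        (d(L k := d (L k) - 1)) (L (\<mu> v - 1)) + (d(L k := d (L k) - 1)) (R (\<mu> v - 1))
          \<le> w (\<mu> v - 1) + 1"
    proof (intro ballI impI)
      fix v assume v: "v \<in> X" "0 < \<mu> v"
      have "L (\<mu> v - 1) \<noteq> L k" "R (\<mu> v - 1) \<noteq> L k" using mate[OF v] ne[OF mate'[OF v]] by auto
      then show "(v = L (\<mu> v - 1) \<or> v = R (\<mu> v - 1)) \<and>
        \<mu> (L (\<mu> v - 1)) = \<mu> v \<and> \<mu> (R (\<mu> v - 1)) = \<mu> v \<and>
        (d(L k := d (L k) - 1)) (L (\<mu> v - 1)) + (d(L k := d (L k) - 1)) (R (\<mu> v - 1))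
          \<le> w (\<mu> v - 1) + 1"
        using invariant_mate[OF inv v] by simp
    qed
  qed
  have "(\<Sum>v\<in>R ` E. (d(L k := d (L k) - 1)) v) = (\<Sum>v\<in>R ` E. d v)"
    by (rule sum.cong) (use ne in auto)
  moreover have "(\<Sum>v\<in>L ` E. (d(L k := d (L k) - 1)) v) = (\<Sum>v\<in>L ` E. d v) - 1"
    using k(1) by (simp add: sum.remove[of "L ` E" "L k"])
  ultimately show "potential (d(L k := d (L k) - 1)) = potential d + 1"
    by (simp add: potential_def)
qed

text \<open>Only the left endpoint of the edge matched at \<open>v\<close> is freed; the entry of
  \<open>v\<close> itself is overwritten right afterwards.\<close>

definition release :: "(int \<Rightarrow> int) \<Rightarrow> int \<Rightarrow> int \<Rightarrow> int" where
  "release \<mu> v = (if 0 < \<mu> v then \<mu>(L (\<mu> v - 1) := 0) else \<mu>)"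

text \<open>Raising the price turns the tight edge into one that exceeds its weight by exactly one,
  which is the origin of the error in the invariant. The displaced left vertex becomes free with
  whatever profit it has; the invariant tolerates this on the left only.\<close>

lemma invariant_assign:
  assumes inv: "invariant d \<mu>" and k: "k \<in> E" "\<mu> (L k) = 0" "0 < d (L k)"
    and tight: "d (L k) + d (R k) \<le> w k"
  defines "d' \<equiv> d(R k := d (R k) + 1)"
    and "\<mu>' \<equiv> (release \<mu> (R k))(R k := k + 1, L k := k + 1)"
  shows "invariant d' \<mu>'" "potential d' = potential d + 1"
proof -
  have ne: "R l \<noteq> L k'" if "l \<in> E" "k' \<in> E" for l k' using bipartite[of k' l] that by auto
  have mate: "v = L (\<mu> v - 1) \<or> v = R (\<mu> v - 1)" "\<mu> (L (\<mu> v - 1)) = \<mu> v" "\<mu> (R (\<mu> v - 1)) = \<mu> v"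
     "d (L (\<mu> v - 1)) + d (R (\<mu> v - 1)) \<le> w (\<mu> v - 1) + 1" "\<mu> v - 1 \<in> E"
    if "v \<in> X" "0 < \<mu> v" for v
    using invariant_mate[OF inv that] invariant_mate_edge[OF inv that] by blast+
  have nn: "0 \<le> \<mu> v \<and> \<mu> v \<le> m" if "v \<in> X" for v
    using inv that unfolding invariant_def by blast
  have kX: "L k \<in> X" "R k \<in> X" using k(1) by auto
  \<comment> \<open>Only the edge formerly matched at \<open>R k\<close> conflicts with the update.
    Its left endpoint has been released and its right endpoint is \<open>R k\<close> itself, so
    every other positive entry is an old one and belongs to a different edge.\<close>
  have \<mu>'_old: "\<mu>' v = \<mu> v \<and> \<mu> v \<noteq> \<mu> (R k)" if v: "v \<in> X" "0 < \<mu>' v" "v \<noteq> L k" "v \<noteq> R k" for v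
  proof -
    have "\<mu>' v = release \<mu> (R k) v" using v by (simp add: \<mu>'_def)
    then have 1: "\<mu>' v = \<mu> v" and 2: "0 < \<mu> (R k) \<Longrightarrow> v \<noteq> L (\<mu> (R k) - 1)"
      using v(2) by (auto simp: release_def split: if_splits)
    have "\<mu> v \<noteq> \<mu> (R k)"
    proof
      assume eq: "\<mu> v = \<mu> (R k)"
      have pos: "0 < \<mu> v" using 1 v(2) by simp
      then have "v = R (\<mu> v - 1)" using mate(1)[OF v(1) pos] 2 eq by auto
      moreover have "R k = R (\<mu> (R k) - 1)"
        using mate(1)[OF kX(2)] mate(5)[OF kX(2)] pos eq ne[OF k(1)] by metis
      ultimately show False using eq v(4) by metis
    qed
    with 1 show ?thesis by simp
  qed
  have \<mu>'_range: "0 \<le> \<mu>' v \<and> \<mu>' v \<le> m" if "v \<in> X" for v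
    using nn[OF that] k(1) by (auto simp: \<mu>'_def release_def)
  have tight': "d (L k) + d (R k) = w k"
    using tight invariant_edge(2)[OF inv k(1)] by simp
  show "invariant d' \<mu>'"
    unfolding invariant_def
  proof (intro conjI)
    \<comment> \<open>Tightness and the positive profit of \<open>L k\<close> leave room for one
      more unit below \<open>W + 1\<close>.\<close>
    have "d (R k) \<le> W" using tight w_le[of k] k by simp
    then show "\<forall>v\<in>X. 0 \<le> d' v \<and> d' v \<le> W + 1"
      using invariant_dual[OF inv] invariant_dual(1)[OF inv kX(2)] by (simp add: d'_def)
    show "\<forall>l\<in>E. d' (L l) \<le> W \<and> w l \<le> d' (L l) + d' (R l)"
    proof
      fix l assume l: "l \<in> E"
      show "d' (L l) \<le> W \<and> w l \<le> d' (L l) + d' (R l)"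
        using invariant_edge[OF inv l] ne[OF k(1) l] by (auto simp: d'_def)
    qed
    show "\<forall>l\<in>E. \<mu>' (R l) = 0 \<longrightarrow> d' (R l) = 0"
    proof (intro ballI impI)
      fix l assume l: "l \<in> E" "\<mu>' (R l) = 0"
      have "R l \<noteq> R k" using l k(1) ne[OF k(1) k(1)] by (auto simp: \<mu>'_def)
      moreover have "R l \<noteq> L k" using ne l(1) k(1) by blast
      moreover have "R l \<noteq> L (\<mu> (R k) - 1)" if "0 < \<mu> (R k)"
        using ne[OF l(1) mate(5)[OF kX(2) that]] .
      ultimately have "\<mu> (R l) = 0" using l by (auto simp: \<mu>'_def release_def split: if_splits)
      then show "d' (R l) = 0" using invariant_free[OF inv l(1)] \<open>R l \<noteq> R k\<close> by (simp add: d'_def)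
    qed
    show "\<forall>v\<in>X. 0 \<le> \<mu>' v \<and> \<mu>' v \<le> m" using \<mu>'_range by blast
    show "\<forall>v\<in>X. 0 < \<mu>' v \<longrightarrow> (v = L (\<mu>' v - 1) \<or> v = R (\<mu>' v - 1)) \<and>
        \<mu>' (L (\<mu>' v - 1)) = \<mu>' v \<and> \<mu>' (R (\<mu>' v - 1)) = \<mu>' v \<and>
        d' (L (\<mu>' v - 1)) + d' (R (\<mu>' v - 1)) \<le> w (\<mu>' v - 1) + 1"
    proof (intro ballI impI)
      fix v assume v: "v \<in> X" "0 < \<mu>' v"
      show "(v = L (\<mu>' v - 1) \<or> v = R (\<mu>' v - 1)) \<and>
        \<mu>' (L (\<mu>' v - 1)) = \<mu>' v \<and> \<mu>' (R (\<mu>' v - 1)) = \<mu>' v \<and>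
        d' (L (\<mu>' v - 1)) + d' (R (\<mu>' v - 1)) \<le> w (\<mu>' v - 1) + 1"
      proof (cases "v = L k \<or> v = R k")
        case True
        have "\<mu>' (L k) = k + 1" "\<mu>' (R k) = k + 1" using ne[OF k(1) k(1)] by (auto simp: \<mu>'_def)
        then show ?thesis using True tight' ne[OF k(1) k(1)] by (auto simp: d'_def)
      next
        case False
        then have *: "\<mu>' v = \<mu> v" "\<mu> v \<noteq> \<mu> (R k)" "0 < \<mu> v" using \<mu>'_old[OF v] v(2) by auto
        note mv = mate[OF v(1) *(3)]
        let ?l = "\<mu> v - 1"
        have "R ?l \<noteq> R k" "L ?l \<noteq> L k" using mv *(2,3) k(2) by auto
        moreover have "L ?l \<noteq> L (\<mu> (R k) - 1)" if "0 < \<mu> (R k)"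
          using mv(2) mate(2)[OF kX(2) that] *(2) by metis
        moreover have "R ?l \<noteq> L (\<mu> (R k) - 1)" if "0 < \<mu> (R k)"
          using ne[OF mv(5) mate(5)[OF kX(2) that]] .
        moreover have "R ?l \<noteq> L k" "L ?l \<noteq> R k" using ne mv(5) k(1) by metis+
        ultimately have "\<mu>' (L ?l) = \<mu> v" "\<mu>' (R ?l) = \<mu> v" "d' (L ?l) = d (L ?l)" "d' (R ?l) = d (R ?l)"
          using mv(2,3) by (auto simp: \<mu>'_def release_def d'_def)
        then show ?thesis using * mv by simp
      qed
    qed
  qed
  have "(\<Sum>v\<in>L ` E. d' v) = (\<Sum>v\<in>L ` E. d v)"
  proof (rule sum.cong)
    fix v assume "v \<in> L ` E"
    then have "v \<noteq> R k" using bipartite k(1) by fastforce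
    then show "d' v = d v" by (simp add: d'_def)
  qed simp
  moreover have "(\<Sum>v\<in>R ` E. d' v) = (\<Sum>v\<in>R ` E. d v) + 1"
    using k(1) by (simp add: d'_def sum.remove[of "R ` E" "R k"])
  ultimately show "potential d' = potential d + 1"
    by (simp add: potential_def)
qed

section \<open>Near-optimality of a settled matching\<close>

text \<open>The entry at a vertex names at most one edge. \<open>matched\<close> inspects left
  endpoints, so for the right side the entry is transferred by the invariant.\<close>

lemma matched_inj:
  assumes "invariant d \<mu>"
  shows "inj_on L (matched \<mu>)" "inj_on R (matched \<mu>)"
proof -
  show "inj_on L (matched \<mu>)"
  proof (rule inj_onI)
    fix k l assume "k \<in> matched \<mu>" "l \<in> matched \<mu>" "L k = L l"
    then have "k + 1 = l + 1" unfolding matched_def by (metis (mono_tags) mem_Collect_eq)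
    then show "k = l" by simp
  qed
  have "\<mu> (R k) = k + 1" if k: "k \<in> E" "\<mu> (L k) = k + 1" for k
  proof -
    have "L k \<in> X" "0 < \<mu> (L k)" using k by auto
    then have "\<mu> (R (\<mu> (L k) - 1)) = \<mu> (L k)" by (rule invariant_mate(3)[OF assms])
    then show ?thesis using k(2) by simp
  qed
  note mate = this
  show "inj_on R (matched \<mu>)"
  proof (rule inj_onI)
    fix k l assume "k \<in> matched \<mu>" "l \<in> matched \<mu>" "R k = R l"
    then have "k + 1 = l + 1" using mate[of k] mate[of l] unfolding matched_def
      by (metis (mono_tags, lifting) mem_Collect_eq)
    then show "k = l" by simp
  qed
qed

text \<open>The duals \<open>d\<close> cover every edge and exceed the weight of a matched edge by at most one, so the
  weight of the final matching is within \<open>card (matched \<mu>) \<le> m\<close> of the optimum.\<close>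

lemma matched_optimal:
  assumes inv: "invariant d \<mu>" and "settled d \<mu>"
    and M: "M \<subseteq> E" "inj_on L M" "inj_on R M"
  shows "sum w M \<le> sum w (matched \<mu>) + m"
proof -
  have d0: "0 \<le> d v" if "v \<in> X" for v using inv that unfolding invariant_def by blast
  have ne: "L k \<noteq> R l" if "l \<in> E" "k \<in> E" for l k using bipartite[of k l] that by auto
  let ?N = "matched \<mu>"
  have N: "?N \<subseteq> E" by (auto simp: matched_def)
  have split: "sum d (L ` K \<union> R ` K) = (\<Sum>k\<in>K. d (L k) + d (R k))"
    if K: "K \<subseteq> E" "inj_on L K" "inj_on R K" for K
  proof -
    have "L k \<noteq> R l" if "k \<in> K" "l \<in> K" for k l
      using ne[of l k] K(1) that by blast
    then have "L ` K \<inter> R ` K = {}" by blast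
    moreover have "finite K" using finite_subset[OF K(1)] by simp
    ultimately have "sum d (L ` K \<union> R ` K) = sum d (L ` K) + sum d (R ` K)"
      by (simp add: sum.union_disjoint)
    then show ?thesis using K by (simp add: sum.reindex sum.distrib)
  qed
  have "sum w M \<le> (\<Sum>k\<in>M. d (L k) + d (R k))"
    by (rule sum_mono) (rule invariant_edge(2)[OF inv subsetD[OF M(1)]])
  also have "\<dots> = sum d (L ` M \<union> R ` M)" using split[OF M] by simp
  also have "\<dots> \<le> sum d X"
  proof (rule sum_mono2)
    show "L ` M \<union> R ` M \<subseteq> X" using M(1) by blast
    show "0 \<le> d v" if "v \<in> X - (L ` M \<union> R ` M)" for v using d0 that by blast
  qed simp
  \<comment> \<open>Unmatched vertices contribute nothing: on the right by the invariant, on the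
    left because the auction has settled.\<close>
  also have "\<dots> = sum d (L ` ?N \<union> R ` ?N)"
  proof (rule sum.mono_neutral_right)
    show "\<forall>v\<in>X - (L ` ?N \<union> R ` ?N). d v = 0"
    proof
      fix v assume v: "v \<in> X - (L ` ?N \<union> R ` ?N)"
      have "\<not> 0 < \<mu> v"
      proof
        assume "0 < \<mu> v"
        have "\<mu> v - 1 \<in> ?N"
          using invariant_mate(2)[OF inv] invariant_mate_edge[OF inv] v \<open>0 < \<mu> v\<close> by (simp add: matched_def)
        moreover have "v = L (\<mu> v - 1) \<or> v = R (\<mu> v - 1)"
          using invariant_mate(1)[OF inv, of v] v \<open>0 < \<mu> v\<close> by simp
        ultimately show False using v by blast
      qed
      then have "\<mu> v = 0" using invariant_mate_range(1)[OF inv, of v] v by simp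
      then show "d v = 0" using invariant_free[OF inv] assms(2) v by (fastforce simp: settled_def)
    qed
    show "L ` ?N \<union> R ` ?N \<subseteq> X" using N by blast
  qed simp
  also have "\<dots> = (\<Sum>k\<in>?N. d (L k) + d (R k))" using split[OF N] matched_inj[OF inv] by simp
  also have "\<dots> \<le> (\<Sum>k\<in>?N. w k + 1)"
  proof (rule sum_mono)
    fix k assume k: "k \<in> ?N"
    then have "L k \<in> X" "0 < \<mu> (L k)" "\<mu> (L k) = k + 1" by (auto simp: matched_def)
    then show "d (L k) + d (R k) \<le> w k + 1" using invariant_mate(4)[OF inv, of "L k"] by simp
  qed
  also have "\<dots> = sum w ?N + int (card ?N)" by (simp add: sum.distrib)
  also have "\<dots> \<le> sum w ?N + m"
    using card_mono[OF _ N] m_nonneg by simp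
  finally show ?thesis .
qed

end

section \<open>Optimal contracts through critical fractions\<close>

definition matchings :: "('v \<times> 'v) set \<Rightarrow> ('v \<times> 'v) set set" where
  "matchings A = {M. M \<subseteq> A \<and> matching M}"

text \<open>Counterpart of \<open>favoured_maximizers\<close> on matchings, with additive reward and
  cost.\<close>

definition lex_best ::
  "('v \<times> 'v) set \<Rightarrow> ('v \<times> 'v \<Rightarrow> real) \<Rightarrow> ('v \<times> 'v \<Rightarrow> real) \<Rightarrow> real \<Rightarrow> ('v \<times> 'v) set \<Rightarrow> bool" where
  "lex_best A f c \<alpha> M \<longleftrightarrow> M \<in> matchings A \<and>
     (\<forall>M'\<in>matchings A. \<alpha> * sum f M' - sum c M' \<le> \<alpha> * sum f M - sum c M \<and>
        (\<alpha> * sum f M' - sum c M' = \<alpha> * sum f M - sum c M \<longrightarrow> sum f M' \<le> sum f M))"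

lemma finite_matchings: "finite A \<Longrightarrow> finite (matchings A)"
  by (rule finite_subset[of _ "Pow A"]) (auto simp: matchings_def)

lemma matchings_nonempty: "{} \<in> matchings A"
  by (simp add: matchings_def matching_def)

lemma reward_attained:
  assumes "finite S"
  obtains M where "M \<in> matchings S" "reward f S = sum f M"
proof -
  have "reward f S = Max (sum f ` matchings S)"
    unfolding reward_def matchings_def by (rule arg_cong[where f = Max]) auto
  moreover have "Max (sum f ` matchings S) \<in> sum f ` matchings S"
    using finite_matchings[OF assms] matchings_nonempty by (intro Max_in) auto
  ultimately show ?thesis using that by auto
qed

lemma reward_matching:
  assumes "finite M" "matching M" "\<And>e. e \<in> M \<Longrightarrow> 0 \<le> f e"
  shows "reward f M = sum f M"
  unfolding reward_def
proof (rule Max_eqI)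
  have "{sum f N |N. N \<subseteq> M \<and> matching N} \<subseteq> sum f ` Pow M" by auto
  then show "finite {sum f N |N. N \<subseteq> M \<and> matching N}"
    using assms(1) by (meson finite_Pow_iff finite_imageI finite_subset)
  show "sum f M \<in> {sum f N |N. N \<subseteq> M \<and> matching N}" using assms(2) by blast
  fix y assume "y \<in> {sum f N |N. N \<subseteq> M \<and> matching N}"
  then show "y \<le> sum f M" using assms by (auto intro: sum_mono2)
qed

lemma lex_best_exists:
  assumes "finite A"
  shows "\<exists>M. lex_best A f c \<alpha> M"
proof -
  let ?u = "\<lambda>M. \<alpha> * sum f M - sum c M"
  define Z where "Z = {M \<in> matchings A. \<forall>M'\<in>matchings A. ?u M' \<le> ?u M}"
  have fin: "finite (matchings A)" using finite_matchings[OF assms] .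
  have "Max (?u ` matchings A) \<in> ?u ` matchings A"
    using fin matchings_nonempty by (intro Max_in) auto
  then obtain M where M: "M \<in> matchings A" "?u M = Max (?u ` matchings A)" by force
  have "M \<in> Z" using M fin by (auto simp: Z_def)
  moreover have finZ: "finite Z" using fin by (simp add: Z_def)
  ultimately have "Max (sum f ` Z) \<in> sum f ` Z" by (intro Max_in) auto
  then obtain M1 where M1: "M1 \<in> Z" "sum f M1 = Max (sum f ` Z)" by force
  have "lex_best A f c \<alpha> M1"
    unfolding lex_best_def
  proof (intro conjI ballI impI)
    show "M1 \<in> matchings A" using M1 by (simp add: Z_def)
    fix M' assume M': "M' \<in> matchings A"
    show "?u M' \<le> ?u M1" using M1 M' by (simp add: Z_def)
    assume "?u M' = ?u M1"
    then have "M' \<in> Z" using M1(1) M' by (simp add: Z_def)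
    then show "sum f M' \<le> sum f M1" using M1(2) finZ by simp
  qed
  then show ?thesis ..
qed

text \<open>\<open>M\<close> is itself a favoured maximizer: an arbitrary set does no better than a
  matching inside it that attains its reward, whose cost is no larger. Membership among the favoured
  maximizers then fixes the reward, whichever set \<open>\<tau>\<close> picks.\<close>

lemma reward_best_response:
  assumes "finite A" "\<And>e. e \<in> A \<Longrightarrow> 0 \<le> f e" "\<And>e. e \<in> A \<Longrightarrow> 0 \<le> c e"
    and "tie_breaking \<tau>" and M: "lex_best A f c \<alpha> M"
  shows "reward f (best_response \<tau> A f c \<alpha>) = sum f M"
proof -
  have MA: "M \<subseteq> A" "matching M" using M by (auto simp: lex_best_def matchings_def)
  have rM: "reward f M = sum f M"
    using MA assms(1,2) by (intro reward_matching) (auto intro: finite_subset)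
  have sub: "agent_utility f c \<alpha> S \<le> \<alpha> * sum f M - sum c M \<and>
      (agent_utility f c \<alpha> S = \<alpha> * sum f M - sum c M \<longrightarrow> reward f S \<le> sum f M)" if "S \<subseteq> A" for S
  proof -
    have "finite S" using that assms(1) finite_subset by blast
    then obtain N where N: "N \<in> matchings S" "reward f S = sum f N" by (rule reward_attained)
    then have NS: "N \<subseteq> S" by (simp add: matchings_def)
    have "sum c N \<le> sum c S" using NS that assms(3) \<open>finite S\<close> by (intro sum_mono2) auto
    moreover have "N \<in> matchings A" using N(1) that by (auto simp: matchings_def)
    ultimately show ?thesis using M N(2) unfolding lex_best_def agent_utility_def cost_def
      by (smt (verit))
  qed
  have uM: "agent_utility f c \<alpha> M = \<alpha> * sum f M - sum c M"
    by (simp add: agent_utility_def cost_def rM)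
  have ma: "agent_utility f c \<alpha> S \<le> agent_utility f c \<alpha> M" if "S \<subseteq> A" for S
    using sub[OF that] uM by simp
  have max_iff: "S \<in> utility_maximizers A f c \<alpha> \<longleftrightarrow>
      S \<subseteq> A \<and> agent_utility f c \<alpha> S = \<alpha> * sum f M - sum c M" for S
    unfolding utility_maximizers_def is_arg_max_linorder mem_Collect_eq uM[symmetric]
    using ma MA(1) by (metis order_antisym)
  have Mmax: "M \<in> utility_maximizers A f c \<alpha>" using max_iff MA(1) uM by blast
  have rmax: "reward f S \<le> reward f M" if "S \<in> utility_maximizers A f c \<alpha>" for S
    using that sub max_iff rM by simp
  have fav_iff: "S \<in> favoured_maximizers A f c \<alpha> \<longleftrightarrow>
      S \<in> utility_maximizers A f c \<alpha> \<and> reward f S = sum f M" for S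
    unfolding favoured_maximizers_def is_arg_max_linorder mem_Collect_eq rM[symmetric]
    using rmax Mmax by (metis order_antisym)
  have "M \<in> favoured_maximizers A f c \<alpha>" using fav_iff Mmax rM by blast
  then have "best_response \<tau> A f c \<alpha> \<in> favoured_maximizers A f c \<alpha>"
    using assms(4) unfolding best_response_def tie_breaking_def by blast
  then show ?thesis using fav_iff by blast
qed

lemma lex_best_scale:
  assumes "\<kappa> > 0"
  shows "lex_best A (\<lambda>e. \<kappa> * f e) (\<lambda>e. \<kappa> * c e) \<alpha> M \<longleftrightarrow> lex_best A f c \<alpha> M"
proof -
  have *: "\<alpha> * (\<kappa> * sum f N) - \<kappa> * sum c N = \<kappa> * (\<alpha> * sum f N - sum c N)" for N
    by (simp add: algebra_simps)
  show ?thesis using assms unfolding lex_best_def sum_distrib_left[symmetric] * by simp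
qed

text \<open>A matching that is optimal at \<open>\<beta>\<close> stays optimal while \<open>\<alpha>\<close> decreases until a competitor of smaller
  reward ties with it; that critical value is a fraction with denominator at most \<open>N\<close>.\<close>

lemma critical_contract:
  fixes f c :: "'v \<times> 'v \<Rightarrow> nat"
  assumes "finite A" "lex_best A f c \<beta> M" "0 \<le> \<beta>" "\<beta> \<le> 1" "sum f A \<le> N"
  obtains a b where "1 \<le> b" "b \<le> N + 1" "a \<le> b" "real a / real b \<le> \<beta>"
    "\<forall>M'\<in>matchings A.
       real a / real b * real (sum f M') - real (sum c M') \<le> real a / real b * real (sum f M) - real (sum c M)"
proof -
  have MA: "M \<subseteq> A" using assms(2) by (simp add: lex_best_def matchings_def)
  have opt: "\<beta> * real (sum f M') - real (sum c M') \<le> \<beta> * real (sum f M) - real (sum c M)"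
    if "M' \<in> matchings A" for M' using assms(2) that by (simp add: lex_best_def)
  \<comment> \<open>\<open>r M'\<close> is the contract at which \<open>M\<close> and
    \<open>M'\<close> give the agent the same utility.\<close>
  define r where "r M' = (real (sum c M) - real (sum c M')) / (real (sum f M) - real (sum f M'))" for M'
  define Z where "Z = {M' \<in> matchings A. sum f M' < sum f M \<and> sum c M' < sum c M}"
  have "finite Z" using finite_matchings[OF assms(1)] by (simp add: Z_def)
  \<comment> \<open>Zero is included because a contract cannot drop below it; it is also the value
    when no competitor has both smaller reward and smaller cost.\<close>
  define \<alpha> where "\<alpha> = Max (insert 0 (r ` Z))"
  have rZ: "r M' \<le> \<beta>" if "M' \<in> Z" for M'
  proof -
    have "sum f M' < sum f M" "M' \<in> matchings A" using that by (auto simp: Z_def)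
    then have "real (sum f M) - real (sum f M') > 0" by (simp only: of_nat_less_iff diff_gt_0_iff_gt)
    then show ?thesis using opt[OF \<open>M' \<in> matchings A\<close>] unfolding r_def
      by (simp add: pos_divide_le_eq algebra_simps del: of_nat_sum)
  qed
  then have le: "\<alpha> \<le> \<beta>" using \<open>finite Z\<close> assms(3) by (simp add: \<alpha>_def)
  have best: "\<alpha> * real (sum f M') - real (sum c M') \<le> \<alpha> * real (sum f M) - real (sum c M)"
    if M': "M' \<in> matchings A" for M'
  proof (cases "sum f M' < sum f M")
    case True
    then have pos: "real (sum f M) - real (sum f M') > 0" by (simp only: of_nat_less_iff diff_gt_0_iff_gt)
    have "r M' \<le> \<alpha>"
    proof (cases "sum c M' < sum c M")
      case True
      then have "M' \<in> Z" using \<open>sum f M' < sum f M\<close> M' by (simp add: Z_def)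
      then show ?thesis using \<open>finite Z\<close> by (simp add: \<alpha>_def)
    next
      case False
      then have "real (sum c M) - real (sum c M') \<le> 0" by (simp only: of_nat_le_iff diff_le_0_iff_le not_less)
      then have "r M' \<le> 0" using pos unfolding r_def by (rule divide_nonpos_pos)
      also have "0 \<le> \<alpha>" using \<open>finite Z\<close> by (simp add: \<alpha>_def)
      finally show ?thesis .
    qed
    then show ?thesis using pos unfolding r_def
      by (simp add: pos_divide_le_eq algebra_simps del: of_nat_sum)
  next
    case False
    \<comment> \<open>When the contract decreases, a competitor with at least the reward of
      \<open>M\<close> loses at least as much as \<open>M\<close>, so the inequality at
      \<open>\<beta>\<close> persists.\<close>
    then have "\<alpha> * (real (sum f M') - real (sum f M)) \<le> \<beta> * (real (sum f M') - real (sum f M))"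
      using le by (intro mult_right_mono) (simp_all only: not_less diff_ge_0_iff_ge of_nat_le_iff)
    then show ?thesis using opt[OF M'] by (simp add: algebra_simps del: of_nat_sum)
  qed
  have "\<alpha> \<in> insert 0 (r ` Z)" unfolding \<alpha>_def using \<open>finite Z\<close> by (intro Max_in) auto
  then consider "\<alpha> = 0" | M' where "M' \<in> Z" "\<alpha> = r M'" by blast
  then show ?thesis
  proof cases
    case 1
    then show ?thesis using that[of 1 0] best le by simp
  next
    case 2
    define a b where "a = sum c M - sum c M'" and "b = sum f M - sum f M'"
    have lt: "sum f M' < sum f M" "sum c M' < sum c M" using 2(1) by (auto simp: Z_def)
    have \<alpha>: "\<alpha> = real a / real b" using 2(2) lt by (simp add: r_def a_def b_def of_nat_diff del: of_nat_sum)
    have "1 \<le> b" using lt by (simp add: b_def)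
    have "sum f M \<le> sum f A" by (rule sum_mono2) (use MA assms(1) in auto)
    then have "b \<le> N + 1" using assms(5) by (simp add: b_def)
    have "real a / real b \<le> 1" using \<alpha> le assms(4) by simp
    then have "a \<le> b" using \<open>1 \<le> b\<close> by simp
    show ?thesis using that[of b a] \<open>1 \<le> b\<close> \<open>b \<le> N + 1\<close> \<open>a \<le> b\<close> le best \<alpha> by simp
  qed
qed

text \<open>Passing from \<open>\<beta>\<close> to its critical fraction shrinks neither the
  principal's share nor the reward: \<open>M\<close> still maximizes the agent's utility there, and
  ties go to the larger reward. Hence a comparison with finitely many fractions settles
  optimality.\<close>

lemma optimal_contractI:
  fixes f c :: "'v \<times> 'v \<Rightarrow> nat"
  assumes "finite A" "sum f A \<le> N" "tie_breaking \<tau>" "\<kappa> > 0"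
    and ab: "0 < B" "a \<le> B" "lex_best A f c (real a / real B) M\<^sub>0"
    and best: "\<And>a' b' M. 1 \<le> b' \<Longrightarrow> b' \<le> N + 1 \<Longrightarrow> a' \<le> b' \<Longrightarrow> lex_best A f c (real a' / real b') M \<Longrightarrow>
      (1 - real a' / real b') * real (sum f M) \<le> (1 - real a / real B) * real (sum f M\<^sub>0)"
  shows "optimal_contract \<tau> A (\<lambda>e. \<kappa> * real (f e)) (\<lambda>e. \<kappa> * real (c e)) (real a / real B)"
proof -
  let ?f = "\<lambda>e. \<kappa> * real (f e)" and ?c = "\<lambda>e. \<kappa> * real (c e)"
  have utility: "principal_utility ?f \<beta> (best_response \<tau> A ?f ?c \<beta>) = \<kappa> * ((1 - \<beta>) * real (sum f M))"
    if "lex_best A f c \<beta> M" for \<beta> M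
  proof -
    have "reward ?f (best_response \<tau> A ?f ?c \<beta>) = sum ?f M"
      using assms(1,3,4) iffD2[OF lex_best_scale[OF assms(4)] that] by (intro reward_best_response) simp_all
    then show ?thesis by (simp add: principal_utility_def mult.left_commute flip: sum_distrib_left)
  qed
  have "(1 - \<beta>) * real (sum f M) \<le> (1 - real a / real B) * real (sum f M\<^sub>0)"
    if \<beta>: "0 \<le> \<beta>" "\<beta> \<le> 1" and M: "lex_best A f c \<beta> M" for \<beta> M
  proof -
    obtain a' b' where *: "1 \<le> b'" "b' \<le> N + 1" "a' \<le> b'" "real a' / real b' \<le> \<beta>"
      "\<forall>M'\<in>matchings A. real a' / real b' * real (sum f M') - real (sum c M')
         \<le> real a' / real b' * real (sum f M) - real (sum c M)"
      by (rule critical_contract[OF assms(1) M \<beta> assms(2)])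
    let ?\<alpha> = "real a' / real b'"
    obtain M1 where M1: "lex_best A f c ?\<alpha> M1" using lex_best_exists[OF assms(1)] by blast
    have "M \<in> matchings A" "M1 \<in> matchings A" using M M1 by (auto simp: lex_best_def)
    then have "real (sum f M) \<le> real (sum f M1)"
      using M1 bspec[OF *(5) \<open>M1 \<in> matchings A\<close>] \<open>M \<in> matchings A\<close>
      unfolding lex_best_def of_nat_sum by (blast intro: order_antisym)
    then have "(1 - \<beta>) * real (sum f M) \<le> (1 - ?\<alpha>) * real (sum f M1)"
      using *(4) \<beta>(2) by (intro mult_mono) (auto intro: sum_nonneg)
    also have "\<dots> \<le> (1 - real a / real B) * real (sum f M\<^sub>0)"
      by (rule best[OF *(1-3) M1])
    finally show ?thesis .
  qed
  note compare = this
  have "principal_utility ?f \<beta> (best_response \<tau> A ?f ?c \<beta>)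
      \<le> principal_utility ?f (real a / real B) (best_response \<tau> A ?f ?c (real a / real B))"
    if \<beta>: "0 \<le> \<beta>" "\<beta> \<le> 1" for \<beta>
  proof -
    obtain M where M: "lex_best A f c \<beta> M" using lex_best_exists[OF assms(1)] by blast
    show ?thesis unfolding utility[OF ab(3)] utility[OF M]
      by (rule mult_left_mono[OF compare[OF \<beta> M]]) (use \<open>\<kappa> > 0\<close> in simp)
  qed
  then show ?thesis
    unfolding optimal_contract_def is_arg_max_linorder using ab(1,2) by simp
qed

section \<open>The program\<close>

text \<open>Reports one plus the index of the last hit, or 0 if there is none. The scan never stops
  early, so it remains a counting loop.\<close>

definition search :: "bexp \<Rightarrow> vname \<Rightarrow> com" where
  "search b x = Seq (Assign x (Lit 0))
     (For ''k'' ''edges'' (Cond b (Assign x (Add (Var ''k'') (Lit 1))) Skip))"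

definition accumulate :: "bexp \<Rightarrow> vname \<Rightarrow> com" where
  "accumulate b x = Seq (Assign x (Lit 0))
     (For ''k'' ''edges''
       (Cond b (Assign x (Add (Var x) (Elem ''reward'' (Var ''k'')))) Skip))"

definition prepare :: com where
  "prepare = For ''k'' ''edges''
     (Seq (Store ''weight'' (Var ''k'') (Mul (Add (Var ''edges'') (Lit 1))
            (Add (Mul (Sub (Mul (Var ''a'') (Elem ''reward'' (Var ''k'')))
                           (Mul (Var ''b'') (Elem ''cost'' (Var ''k''))))
                      (Add (Var ''total'') (Lit 1)))
                 (Elem ''reward'' (Var ''k'')))))
     (Seq (Store ''dual'' (Elem ''left'' (Var ''k'')) (Var ''bound''))
     (Seq (Store ''mate'' (Elem ''left'' (Var ''k'')) (Lit 0))
     (Seq (Store ''dual'' (Elem ''right'' (Var ''k'')) (Lit 0))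
          (Store ''mate'' (Elem ''right'' (Var ''k'')) (Lit 0))))))"

text \<open>The mate of the right vertex \<open>j\<close> is read before it is overwritten: it leads
  to the left vertex that loses \<open>j\<close>.\<close>

definition assign_edge :: com where
  "assign_edge =
     Seq (Assign ''j'' (Elem ''right'' (Sub (Var ''edge'') (Lit 1))))
    (Seq (Cond (Less (Lit 0) (Elem ''mate'' (Var ''j'')))
            (Store ''mate'' (Elem ''left'' (Sub (Elem ''mate'' (Var ''j'')) (Lit 1))) (Lit 0))
            Skip)
    (Seq (Store ''mate'' (Var ''j'') (Var ''edge''))
    (Seq (Store ''mate'' (Var ''i'') (Var ''edge''))
         (Store ''dual'' (Var ''j'') (Add (Elem ''dual'' (Var ''j'')) (Lit 1))))))"

text \<open>A single move of the auction. Without an active left vertex no dual and no mate changes,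
  so surplus rounds are harmless.\<close>

definition auction_round :: com where
  "auction_round =
     Seq (search (Conj (Less (Elem ''mate'' (Elem ''left'' (Var ''k''))) (Lit 1))
                       (Less (Lit 0) (Elem ''dual'' (Elem ''left'' (Var ''k''))))) ''active'')
    (Cond (Less (Lit 0) (Var ''active''))
      (Seq (Assign ''i'' (Elem ''left'' (Sub (Var ''active'') (Lit 1))))
      (Seq (search (Conj (Conj (Neg (Less (Elem ''left'' (Var ''k'')) (Var ''i'')))
                               (Neg (Less (Var ''i'') (Elem ''left'' (Var ''k'')))))
                         (Neg (Less (Elem ''weight'' (Var ''k''))
                                    (Add (Elem ''dual'' (Var ''i''))
                                         (Elem ''dual'' (Elem ''right'' (Var ''k''))))))) ''edge'')
      (Cond (Less (Lit 0) (Var ''edge''))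
         assign_edge
         (Store ''dual'' (Var ''i'') (Sub (Elem ''dual'' (Var ''i'')) (Lit 1))))))
      Skip)"

text \<open>Compares (1 - x / y) z with (1 - a / b) r, where x / y with value z is held so far and a
  / b with reward r is the candidate; multiplying by y b avoids division.\<close>

definition compare_contract :: com where
  "compare_contract =
     Cond (Less (Mul (Mul (Sub (Var ''denominator'') (Var ''numerator'')) (Var ''value'')) (Var ''b''))
                (Mul (Mul (Sub (Var ''b'') (Var ''a'')) (Var ''gain'')) (Var ''denominator'')))
       (Seq (Assign ''numerator'' (Var ''a''))
       (Seq (Assign ''denominator'' (Var ''b''))
            (Assign ''value'' (Var ''gain''))))
       Skip"

definition matched_edge :: bexp where
  "matched_edge =
     Conj (Neg (Less (Elem ''mate'' (Elem ''left'' (Var ''k''))) (Add (Var ''k'') (Lit 1))))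
          (Neg (Less (Add (Var ''k'') (Lit 1)) (Elem ''mate'' (Elem ''left'' (Var ''k'')))))"

definition try_contract :: com where
  "try_contract =
     Seq prepare
    (Seq (For ''t'' ''rounds'' auction_round)
    (Seq (accumulate matched_edge ''gain'')
         compare_contract))"

text \<open>\<open>span\<close> exceeds the largest denominator N + 1 by one, \<open>bound\<close>
  is an upper bound on all weights, and \<open>rounds\<close> exceeds the range of the potential.
  The loops also visit pairs with b = 0 or a > b; these never win the comparison. The condition
  \<open>Less (Lit 0) (Lit 1)\<close> is constantly true, so the first sum runs over all
  edges.\<close>

definition contract_program :: com where
  "contract_program =
     Seq (accumulate (Less (Lit 0) (Lit 1)) ''total'')
    (Seq (Assign ''span'' (Add (Var ''total'') (Lit 2)))
    (Seq (Assign ''bound'' (Mul (Add (Var ''edges'') (Lit 1))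
            (Mul (Var ''span'') (Mul (Var ''span'') (Var ''span'')))))
    (Seq (Assign ''rounds'' (Mul (Lit 2) (Mul (Add (Var ''edges'') (Lit 1)) (Add (Var ''bound'') (Lit 1)))))
    (Seq (Assign ''denominator'' (Lit 1))
         (For ''b'' ''span'' (For ''a'' ''span'' try_contract))))))"


section \<open>Correctness of the program\<close>

lemma fun_upd_overwrite_first: "x \<noteq> y \<Longrightarrow> g(x := u, y := v, x := u') = g(x := u', y := v)"
  by (simp add: fun_upd_twist)

section \<open>Linear scans over the edge list\<close>

text \<open>The test may read the loop counter but must ignore the result variable, which changes
  during the scan. Any hit serves the auction, so \<open>Q\<close> is demanded for all of
  them.\<close>

lemma computes_search:
  assumes "x \<noteq> ''k''" "x \<noteq> ''edges''" "var s ''edges'' = m" "0 \<le> m"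
    and P: "\<And>i z. bval b (s\<lparr>var := (var s)(''k'' := i, x := z)\<rparr>) \<longleftrightarrow> P i"
    and Q: "\<And>z. (z = 0 \<and> (\<forall>l\<in>{0..<m}. \<not> P l)) \<or> (z - 1 \<in> {0..<m} \<and> P (z - 1)) \<Longrightarrow>
      Q (s\<lparr>var := (var s)(''k'' := m, x := z)\<rparr>)"
  shows "computes B (search b x) s Q"
  unfolding search_def
proof (intro computes_Seq computes_Assign)
  let ?I = "\<lambda>i s1. \<exists>z. s1 = s\<lparr>var := (var s)(''k'' := i, x := z)\<rparr> \<and>
    ((z = 0 \<and> (\<forall>l\<in>{0..<i}. \<not> P l)) \<or> (z - 1 \<in> {0..<i} \<and> P (z - 1)))"
  show "computes B (For ''k'' ''edges'' (Cond b (Assign x (Add (Var ''k'') (Lit 1))) Skip))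
     (s\<lparr>var := (var s)(x := aval (Lit 0) s)\<rparr>) Q"
  proof (rule computes_For[where I = ?I and N = m])
    show "?I 0 (s\<lparr>var := (var s)(x := aval (Lit 0) s)\<rparr>
      \<lparr>var := (var (s\<lparr>var := (var s)(x := aval (Lit 0) s)\<rparr>))(''k'' := 0)\<rparr>)"
      using assms(1) by (intro exI[of _ 0]) (simp add: fun_upd_twist)
    show "var s1 ''k'' = i \<and> var s1 ''edges'' = m" if "?I i s1" for i s1
      using that assms(1-3) by auto
    show "Q s'" if "?I m s'" for s' using that by (elim exE conjE) (simp only: Q)
    fix i s1 assume i: "0 \<le> i" "i < m" "?I i s1"
    then obtain z where s1: "s1 = s\<lparr>var := (var s)(''k'' := i, x := z)\<rparr>"
      and z: "(z = 0 \<and> (\<forall>l\<in>{0..<i}. \<not> P l)) \<or> (z - 1 \<in> {0..<i} \<and> P (z - 1))"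
      by (elim exE conjE)
    have less: "{0..<i + 1} = insert i {0..<i}" using i(1) by auto
    show "computes B (Cond b (Assign x (Add (Var ''k'') (Lit 1))) Skip) s1
      (\<lambda>s'. var s' ''k'' = i \<and> ?I (i + 1) (s'\<lparr>var := (var s')(''k'' := i + 1)\<rparr>))"
    proof (intro computes_Cond computes_Assign computes_Skip)
      assume "bval b s1"
      then have "P i" using P s1 by simp
      show "\<bar>aval (Add (Var ''k'') (Lit 1)) s1\<bar> \<le> int B" if "bounded_state B s1"
      proof -
        have "\<bar>var s1 ''edges''\<bar> \<le> int B" using that by (simp add: bounded_state_def)
        then show ?thesis using i(1,2) assms(1-3) s1 by simp
      qed
      show "var (s1\<lparr>var := (var s1)(x := aval (Add (Var ''k'') (Lit 1)) s1)\<rparr>) ''k'' = i \<and>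
        ?I (i + 1) (s1\<lparr>var := (var s1)(x := aval (Add (Var ''k'') (Lit 1)) s1)\<rparr>
          \<lparr>var := (var (s1\<lparr>var := (var s1)(x := aval (Add (Var ''k'') (Lit 1)) s1)\<rparr>))(''k'' := i + 1)\<rparr>)"
        using \<open>P i\<close> assms(1) i(1) s1 by (intro conjI exI[of _ "i + 1"]) (simp_all add: fun_upd_overwrite_first)
    next
      assume "\<not> bval b s1"
      then have "\<not> P i" using P s1 by simp
      then show "var s1 ''k'' = i \<and> ?I (i + 1) (s1\<lparr>var := (var s1)(''k'' := i + 1)\<rparr>)"
        unfolding less using assms(1) s1 z by (intro conjI exI[of _ z]) (auto simp: fun_upd_overwrite_first)
    qed
  qed (use assms in simp)
qed simp

lemma computes_accumulate:
  assumes "x \<noteq> ''k''" "x \<noteq> ''edges''" "var s ''edges'' = m" "0 \<le> m"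
    and P: "\<And>i z. bval b (s\<lparr>var := (var s)(''k'' := i, x := z)\<rparr>) \<longleftrightarrow> P i"
    and f: "arr s ''reward'' = f" "\<And>k. 0 \<le> k \<Longrightarrow> k < m \<Longrightarrow> 0 \<le> f k" "sum f {0..<m} \<le> int B"
    and Q: "Q (s\<lparr>var := (var s)(''k'' := m, x := sum f {k\<in>{0..<m}. P k})\<rparr>)"
  shows "computes B (accumulate b x) s Q"
  unfolding accumulate_def
proof (intro computes_Seq computes_Assign)
  let ?S = "\<lambda>i. sum f {k\<in>{0..<i}. P k}"
  let ?I = "\<lambda>i s1. s1 = s\<lparr>var := (var s)(''k'' := i, x := ?S i)\<rparr>"
  let ?P = "Cond b (Assign x (Add (Var x) (Elem ''reward'' (Var ''k'')))) Skip"
  show "computes B (For ''k'' ''edges'' ?P) (s\<lparr>var := (var s)(x := aval (Lit 0) s)\<rparr>) Q"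
  proof (rule computes_For[where I = ?I and N = m])
    show "?I 0 (s\<lparr>var := (var s)(x := aval (Lit 0) s)\<rparr>
      \<lparr>var := (var (s\<lparr>var := (var s)(x := aval (Lit 0) s)\<rparr>))(''k'' := 0)\<rparr>)"
      using assms(1) by (simp add: fun_upd_twist)
    show "var s1 ''k'' = i \<and> var s1 ''edges'' = m" if "?I i s1" for i s1
      using that assms(1-3) by auto
    show "Q s'" if "?I m s'" for s' using that Q by (simp only:)
    fix i s1 assume i: "0 \<le> i" "i < m" and s1: "?I i s1"
    have ins: "{0..<i + 1} = insert i {0..<i}" using i(1) by auto
    have S: "?S (i + 1) = (if P i then ?S i + f i else ?S i)"
      unfolding sum.inter_filter[OF finite_atLeastLessThan_int] unfolding ins by simp
    \<comment> \<open>Nonnegative rewards keep each partial sum below the total, which is assumed to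
      fit.\<close>
    have range: "0 \<le> ?S (i + 1)" "?S (i + 1) \<le> sum f {0..<m}"
      using i f(2) by (auto intro!: sum_nonneg sum_mono2)
    show "computes B ?P s1
      (\<lambda>s'. var s' ''k'' = i \<and> ?I (i + 1) (s'\<lparr>var := (var s')(''k'' := i + 1)\<rparr>))"
    proof (intro computes_Cond computes_Assign computes_Skip)
      assume "bval b s1"
      then have "P i" using P s1 by simp
      have val: "aval (Add (Var x) (Elem ''reward'' (Var ''k''))) s1 = ?S (i + 1)"
        using s1 assms(1) f(1) S \<open>P i\<close> by simp
      show "\<bar>aval (Add (Var x) (Elem ''reward'' (Var ''k''))) s1\<bar> \<le> int B"
        unfolding val using range f(3) by linarith
      show "var (s1\<lparr>var := (var s1)(x := aval (Add (Var x) (Elem ''reward'' (Var ''k''))) s1)\<rparr>) ''k'' = i \<and>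
        ?I (i + 1) (s1\<lparr>var := (var s1)(x := aval (Add (Var x) (Elem ''reward'' (Var ''k''))) s1)\<rparr>
          \<lparr>var := (var (s1\<lparr>var := (var s1)(x := aval (Add (Var x) (Elem ''reward'' (Var ''k''))) s1)\<rparr>))
            (''k'' := i + 1)\<rparr>)"
        unfolding val using assms(1) s1 by (simp add: fun_upd_overwrite_first)
    next
      assume "\<not> bval b s1"
      then have "\<not> P i" using P s1 by simp
      then show "var s1 ''k'' = i \<and> ?I (i + 1) (s1\<lparr>var := (var s1)(''k'' := i + 1)\<rparr>)"
        using assms(1) s1 S by (simp add: fun_upd_overwrite_first)
    qed
  qed (use assms in simp)
qed simp

section \<open>The integral matching problem and the size of its weights\<close>

locale contract_instance =
  fixes m :: int and L R f c :: "int \<Rightarrow> int" and cmax :: int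
  assumes m_nonneg: "0 \<le> m"
    and bipartite: "\<And>k l. 0 \<le> k \<Longrightarrow> k < m \<Longrightarrow> 0 \<le> l \<Longrightarrow> l < m \<Longrightarrow> L k \<noteq> R l"
    and f_nonneg: "\<And>k. 0 \<le> k \<Longrightarrow> k < m \<Longrightarrow> 0 \<le> f k"
    and c_range: "\<And>k. 0 \<le> k \<Longrightarrow> k < m \<Longrightarrow> 0 \<le> c k \<and> c k \<le> cmax"
begin

definition reward_sum :: int where
  "reward_sum = sum f {0..<m}"

definition span :: int where
  "span = reward_sum + 2"

definition bound :: int where
  "bound = (m + 1) * (span * (span * span))"

definition rounds :: int where
  "rounds = 2 * ((m + 1) * (bound + 1))"

definition objective :: "int \<Rightarrow> int \<Rightarrow> int \<Rightarrow> int" where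
  "objective a b k = (a * f k - b * c k) * (reward_sum + 1) + f k"

definition weight :: "int \<Rightarrow> int \<Rightarrow> int \<Rightarrow> int" where
  "weight a b k = (m + 1) * objective a b k"

text \<open>As the two sides are disjoint, edges can meet only in a common left or a common right
  endpoint.\<close>

definition index_matching :: "int set \<Rightarrow> bool" where
  "index_matching K \<longleftrightarrow> K \<subseteq> {0..<m} \<and> inj_on L K \<and> inj_on R K"

text \<open>A relation, because several index sets may maximize the objective; for b > 0 its value
  is identified in \<open>lex_best_reward\<close>. It is meaningful for b = 0 too, which the program
  visits.\<close>

definition response_reward :: "int \<Rightarrow> int \<Rightarrow> int \<Rightarrow> bool" where
  "response_reward a b r \<longleftrightarrow> (\<exists>K. index_matching K \<and> sum f K = r \<and>
     (\<forall>K'. index_matching K' \<longrightarrow> sum (objective a b) K' \<le> sum (objective a b) K))"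

lemma reward_sum_nonneg: "0 \<le> reward_sum"
  unfolding reward_sum_def by (rule sum_nonneg) (use f_nonneg in auto)

lemma f_le_reward_sum: "0 \<le> k \<Longrightarrow> k < m \<Longrightarrow> f k \<le> reward_sum"
  unfolding reward_sum_def using f_nonneg by (intro member_le_sum) auto

text \<open>Costs enter negatively, so discarding them leaves a cubic in \<open>span\<close>. The
  auction asks for an upper bound only.\<close>

lemma objective_le:
  assumes "0 \<le> a" "a < span" "0 \<le> b" "0 \<le> k" "k < m"
  shows "objective a b k \<le> span * (span * span)"
proof -
  have "a * f k \<le> (reward_sum + 1) * reward_sum"
    using assms f_nonneg[OF assms(4,5)] f_le_reward_sum[OF assms(4,5)] by (intro mult_mono) (auto simp: span_def)
  moreover have "0 \<le> b * c k" using assms c_range[OF assms(4,5)] by simp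
  ultimately have "a * f k - b * c k \<le> (reward_sum + 1) * reward_sum" by linarith
  then have "(a * f k - b * c k) * (reward_sum + 1) \<le> (reward_sum + 1) * reward_sum * (reward_sum + 1)"
    using reward_sum_nonneg by (intro mult_right_mono) auto
  then have "objective a b k \<le> (reward_sum + 1) * reward_sum * (reward_sum + 1) + reward_sum"
    using f_le_reward_sum[OF assms(4,5)] by (simp add: objective_def)
  also have "\<dots> \<le> span * (span * span)"
    using reward_sum_nonneg by (simp add: span_def algebra_simps)
  finally show ?thesis .
qed

text \<open>Stored weights must be bounded on both sides. The lower estimate is where
  \<open>cmax\<close> enters; it affects the size of the values but not the number of
  rounds.\<close>

lemma abs_weight_le:
  assumes "0 \<le> a" "a < span" "0 \<le> b" "b < span" "0 \<le> k" "k < m"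
  shows "\<bar>weight a b k\<bar> \<le> (m + 1) * (span * (span * span) + span * cmax * span)"
proof -
  have c: "0 \<le> c k" "c k \<le> cmax" using c_range[OF assms(5,6)] by auto
  have "- (span * cmax * span) \<le> objective a b k"
  proof -
    have "b * c k \<le> span * cmax" using assms c by (intro mult_mono) auto
    moreover have "0 \<le> a * f k" using assms f_nonneg by simp
    ultimately have "- (span * cmax) \<le> a * f k - b * c k" by linarith
    then have "- (span * cmax) * (reward_sum + 1) \<le> (a * f k - b * c k) * (reward_sum + 1)"
      using reward_sum_nonneg by (intro mult_right_mono) auto
    moreover have "span * cmax * (reward_sum + 1) \<le> span * cmax * span"
      using c reward_sum_nonneg by (intro mult_left_mono) (auto simp: span_def)
    ultimately show ?thesis using f_nonneg[OF assms(5,6)] by (simp add: objective_def)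
  qed
  moreover have "objective a b k \<le> span * (span * span)" using objective_le assms by simp
  moreover have "0 \<le> span * cmax * span" "0 \<le> span * (span * span)"
    using c reward_sum_nonneg by (auto simp: span_def)
  ultimately have "\<bar>objective a b k\<bar> \<le> span * (span * span) + span * cmax * span" by linarith
  then show ?thesis using m_nonneg unfolding weight_def abs_mult by (intro mult_mono) auto
qed

lemma bound_nonneg: "0 \<le> bound"
  using m_nonneg reward_sum_nonneg by (simp add: bound_def span_def)

lemma auction_weight:
  assumes "0 \<le> a" "a < span" "0 \<le> b"
  shows "auction m L R (weight a b) bound"
proof
  show "weight a b k \<le> bound" if "0 \<le> k" "k < m" for k
    unfolding weight_def bound_def using objective_le[OF assms that] m_nonneg by (intro mult_left_mono) auto
qed (use m_nonneg bipartite bound_nonneg in auto)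

lemma response_rewardI:
  assumes "0 \<le> a" "a < span" "0 \<le> b"
    and "auction.invariant m L R (weight a b) bound d \<mu>" "auction.settled m L d \<mu>"
  shows "response_reward a b (sum f {k\<in>{0..<m}. \<mu> (L k) = k + 1})"
proof -
  interpret auction m L R "weight a b" bound by (rule auction_weight[OF assms(1-3)])
  let ?K = "matched \<mu>"
  have K: "index_matching ?K"
    using matched_inj[OF assms(4)] by (auto simp: index_matching_def matched_def)
  have "sum (objective a b) K' \<le> sum (objective a b) ?K" if "index_matching K'" for K'
  proof -
    have "sum (weight a b) K' \<le> sum (weight a b) ?K + m"
      using matched_optimal[OF assms(4,5)] that by (simp add: index_matching_def)
    then have "(m + 1) * sum (objective a b) K' \<le> (m + 1) * sum (objective a b) ?K + m"
      by (simp add: weight_def[abs_def] sum_distrib_left)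
    then have "(m + 1) * sum (objective a b) K' < (m + 1) * (sum (objective a b) ?K + 1)"
      by (simp add: distrib_left)
    then show ?thesis using m_nonneg by (simp add: mult_less_cancel_left)
  qed
  then show ?thesis unfolding response_reward_def using K by (auto simp: matched_def)
qed

text \<open>The state outside the working arrays: the input, the precomputed parameters, the current
  candidate (a, b), and the best fraction x / y so far with its value z.\<close>

definition frame :: "int \<Rightarrow> int \<Rightarrow> int \<Rightarrow> int \<Rightarrow> int \<Rightarrow> state \<Rightarrow> bool" where
  "frame a b x y z s \<longleftrightarrow>
     var s ''edges'' = m \<and> var s ''total'' = reward_sum \<and> var s ''span'' = span \<and>
     var s ''bound'' = bound \<and> var s ''rounds'' = rounds \<and>
     arr s ''left'' = L \<and> arr s ''right'' = R \<and> arr s ''reward'' = f \<and> arr s ''cost'' = c \<and>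
     var s ''a'' = a \<and> var s ''b'' = b \<and>
     var s ''numerator'' = x \<and> var s ''denominator'' = y \<and> var s ''value'' = z"

definition weighted :: "int \<Rightarrow> int \<Rightarrow> int \<Rightarrow> int \<Rightarrow> int \<Rightarrow> state \<Rightarrow> bool" where
  "weighted a b x y z s \<longleftrightarrow> frame a b x y z s \<and>
     (\<forall>k. 0 \<le> k \<longrightarrow> k < m \<longrightarrow> arr s ''weight'' k = weight a b k)"

end

locale bounded_instance = contract_instance +
  fixes B :: nat
  assumes rounds_le: "rounds \<le> int B"
    and span_le: "span \<le> int B"
    and weights_le: "(m + 1) * (span * (span * span) + span * cmax * span) \<le> int B"
begin

text \<open>Duals reach at most \<open>bound + 1\<close> and mates at most \<open>m\<close>, so the
  single assumption on \<open>rounds\<close> keeps both within \<open>B\<close>.\<close>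

lemma bound_less_rounds: "bound + 1 \<le> rounds" "m + 1 \<le> rounds"
proof -
  have "1 * (bound + 1) \<le> (m + 1) * (bound + 1)" "(m + 1) * 1 \<le> (m + 1) * (bound + 1)"
    using m_nonneg bound_nonneg by (intro mult_right_mono mult_left_mono; simp)+
  moreover have "rounds = (m + 1) * (bound + 1) + (m + 1) * (bound + 1)" by (simp add: rounds_def)
  ultimately show "bound + 1 \<le> rounds" "m + 1 \<le> rounds"
    using m_nonneg bound_nonneg by simp_all
qed

lemma computes_prepare:
  assumes "frame a b x y z s" "0 \<le> a" "a < span" "0 \<le> b" "b < span"
  shows "computes B prepare s (\<lambda>s'. weighted a b x y z s' \<and>
    (\<forall>k. 0 \<le> k \<longrightarrow> k < m \<longrightarrow> arr s' ''dual'' (L k) = bound \<and> arr s' ''dual'' (R k) = 0 \<and>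
       arr s' ''mate'' (L k) = 0 \<and> arr s' ''mate'' (R k) = 0))"
  unfolding prepare_def
proof (rule computes_For[where N = m and I = "\<lambda>i s'. frame a b x y z s' \<and> var s' ''k'' = i \<and>
    (\<forall>k. 0 \<le> k \<longrightarrow> k < i \<longrightarrow> arr s' ''weight'' k = weight a b k \<and>
       arr s' ''dual'' (L k) = bound \<and> arr s' ''dual'' (R k) = 0 \<and>
       arr s' ''mate'' (L k) = 0 \<and> arr s' ''mate'' (R k) = 0)"], goal_cases)
  case (4 i s')
  \<comment> \<open>Since the sides are disjoint, resetting a right endpoint never destroys the
    values at a left one; a vertex shared by several edges receives the same values each
    time.\<close>
  have ne: "L k \<noteq> R l \<and> R l \<noteq> L k" if "0 \<le> k" "k < i + 1" "0 \<le> l" "l < i + 1" for k l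
    using bipartite[of k l] that 4(2) by auto
  have w: "\<bar>weight a b i\<bar> \<le> int B"
    using abs_weight_le[OF assms(2-5) 4(1,2)] weights_le by linarith
  have b: "\<bar>bound\<bar> \<le> int B" using bound_nonneg bound_less_rounds rounds_le by linarith
  have fr: "frame a b x y z s'" and k: "var s' ''k'' = i" using 4(3) by simp_all
  have fr': "var s' ''edges'' = m" "var s' ''total'' = reward_sum" "var s' ''bound'' = bound"
    "arr s' ''left'' = L" "arr s' ''right'' = R" "arr s' ''reward'' = f" "arr s' ''cost'' = c"
    "var s' ''a'' = a" "var s' ''b'' = b"
    using fr unfolding frame_def by blast+
  have old: "arr s' ''weight'' k = weight a b k \<and>
       arr s' ''dual'' (L k) = bound \<and> arr s' ''dual'' (R k) = 0 \<and>
       arr s' ''mate'' (L k) = 0 \<and> arr s' ''mate'' (R k) = 0" if "0 \<le> k" "k < i" for k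
    using 4(3) that by simp
  have less: "k < i \<or> k = i" if "k < i + 1" for k using that by auto
  show ?case
  proof (intro computes_Seq computes_Store_fresh, goal_cases)
    case 1
    show ?case using w unfolding weight_def objective_def by (simp only: aval.simps fr' k)
  next
    case (2 s1)
    then show ?case using b by (simp add: fr')
  next
    case (6 s1 s2 s3 s4 s5)
    note upd = 6(1,3,5,7,9) 6(2,4,6,8,10)
    have "arr s5 ''weight'' = (arr s' ''weight'')(i := weight a b i)"
      by (simp add: upd fr' k weight_def objective_def)
    moreover have "arr s5 ''dual'' = (arr s' ''dual'')(L i := bound, R i := 0)"
      "arr s5 ''mate'' = (arr s' ''mate'')(L i := 0, R i := 0)"
      by (simp_all add: upd fr' k)
    moreover have "frame a b x y z (s5\<lparr>var := (var s5)(''k'' := i + 1)\<rparr>)"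
      using fr by (simp add: frame_def upd)
    moreover have "var s5 ''k'' = i" by (simp add: upd k)
    ultimately show ?case
      using old less ne 4(1) by (auto dest!: less)
  qed simp_all
qed (use assms m_nonneg in \<open>auto simp: frame_def weighted_def\<close>)

section \<open>Executing an auction round\<close>

text \<open>The second alternative demands an unsettled start, so a settled state can only be
  followed by a settled one, and rounds can be counted against the potential without tracking when
  the auction settled.\<close>

definition progress :: "int \<Rightarrow> int \<Rightarrow> int \<Rightarrow> int \<Rightarrow> int \<Rightarrow> state \<Rightarrow> state \<Rightarrow> bool" where
  "progress a b x y z s s' \<longleftrightarrow> weighted a b x y z s' \<and> var s' ''t'' = var s ''t'' \<and>
     auction.invariant m L R (weight a b) bound (arr s' ''dual'') (arr s' ''mate'') \<and>
     (auction.settled m L (arr s' ''dual'') (arr s' ''mate'') \<or>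
      \<not> auction.settled m L (arr s ''dual'') (arr s ''mate'') \<and>
      auction.potential m L R (arr s' ''dual'') = auction.potential m L R (arr s ''dual'') + 1)"

lemma computes_assign_edge:
  assumes w: "weighted a b x y z s" and ab: "0 \<le> a" "a < span" "0 \<le> b"
    and inv: "auction.invariant m L R (weight a b) bound (arr s ''dual'') (arr s ''mate'')"
    and l: "0 \<le> l" "l < m" "var s ''edge'' = l + 1" "var s ''i'' = L l"
    and free: "arr s ''mate'' (L l) = 0" "0 < arr s ''dual'' (L l)"
    and tight: "arr s ''dual'' (L l) + arr s ''dual'' (R l) \<le> weight a b l"
  shows "computes B assign_edge s (progress a b x y z s)"
proof -
  interpret auction m L R "weight a b" bound by (rule auction_weight[OF ab])
  let ?d = "arr s ''dual''" and ?\<mu> = "arr s ''mate''"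
  have lE: "l \<in> E" using l by simp
  note new = invariant_assign[OF inv lE free tight]
  have unsettled: "\<not> settled ?d ?\<mu>" using free lE by (auto simp: settled_def)
  \<comment> \<open>The invariant after the move bounds the price about to be stored.\<close>
  have "?d (R l) + 1 \<le> bound + 1" "0 \<le> ?d (R l)"
    using invariant_dual(2)[OF new(1), of "R l"] invariant_dual(1)[OF inv, of "R l"] lE by auto
  then have d_le: "\<bar>?d (R l) + 1\<bar> \<le> int B"
    using bound_less_rounds rounds_le by linarith
  have fr: "arr s ''left'' = L" "arr s ''right'' = R"
    using w by (simp_all add: weighted_def frame_def)
  have fin: "progress a b x y z s s'"
    if "weighted a b x y z s'" "var s' ''t'' = var s ''t''"
      "arr s' ''mate'' = (release ?\<mu> (R l))(R l := l + 1, L l := l + 1)"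
      "arr s' ''dual'' = ?d(R l := ?d (R l) + 1)" for s'
    using that new unsettled by (simp add: progress_def)
  have edge: "\<bar>var s ''edge''\<bar> \<le> int B"
    using l bound_less_rounds rounds_le by simp
  have ne: "R l \<noteq> L l" using bipartite[of l l] l by simp
  show ?thesis
    unfolding assign_edge_def
  proof (intro computes_Seq computes_Assign_fresh computes_Cond computes_Store_fresh computes_Skip, goal_cases)
    case 1
    then show ?case by (simp add: bounded_state_def)
  next
    case (2 s1)
    then show ?case by simp
  next
    case (3 s1 s2)
    then show ?case using edge by simp
  next
    case (4 s1 s2 s3)
    then show ?case using edge by simp
  next
    case (5 s1 s2 s3 s4)
    then show ?case using fr l d_le ne by simp
  next
    case (6 s1 s2 s3 s4 s5)
    have "weighted a b x y z s5" using w 6 by (simp add: weighted_def frame_def)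
    moreover have "arr s5 ''mate'' = (release ?\<mu> (R l))(R l := l + 1, L l := l + 1)"
      "arr s5 ''dual'' = ?d(R l := ?d (R l) + 1)" "var s5 ''t'' = var s ''t''"
      using 6 fr l ne by (simp_all add: release_def)
    ultimately show ?case by (intro fin)
  next
    \<comment> \<open>From here on the right vertex was free, and \<open>release\<close> changes
      nothing.\<close>
    case (7 s1)
    then show ?case using edge by simp
  next
    case (8 s1 s2)
    then show ?case using edge by simp
  next
    case (9 s1 s2 s3)
    then show ?case using fr l d_le ne by simp
  next
    case (10 s1 s2 s3 s4)
    have "weighted a b x y z s4" using w 10 by (simp add: weighted_def frame_def)
    moreover have "arr s4 ''mate'' = (release ?\<mu> (R l))(R l := l + 1, L l := l + 1)"
      "arr s4 ''dual'' = ?d(R l := ?d (R l) + 1)" "var s4 ''t'' = var s ''t''"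
      using 10 fr l ne by (simp_all add: release_def)
    ultimately show ?case by (intro fin)
  qed
qed

lemma computes_auction_round:
  assumes w: "weighted a b x y z s" and ab: "0 \<le> a" "a < span" "0 \<le> b"
    and inv: "auction.invariant m L R (weight a b) bound (arr s ''dual'') (arr s ''mate'')"
  shows "computes B auction_round s (progress a b x y z s)"
proof -
  interpret auction m L R "weight a b" bound by (rule auction_weight[OF ab])
  let ?d = "arr s ''dual''" and ?\<mu> = "arr s ''mate''"
  have fr: "arr s ''left'' = L" "arr s ''right'' = R" "var s ''edges'' = m"
    and wt: "\<And>k. k \<in> E \<Longrightarrow> arr s ''weight'' k = weight a b k"
    using w by (simp_all add: weighted_def frame_def)
  let ?Active = "\<lambda>k. ?\<mu> (L k) < 1 \<and> 0 < ?d (L k)"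
  show ?thesis
    unfolding auction_round_def
  proof (rule computes_Seq, rule computes_search[where m = m and P = ?Active])
    fix v
    let ?s1 = "s\<lparr>var := (var s)(''k'' := m, ''active'' := v)\<rparr>"
    assume v: "v = 0 \<and> (\<forall>l\<in>E. \<not> ?Active l) \<or> v - 1 \<in> E \<and> ?Active (v - 1)"
    show "computes B (Cond (Less (Lit 0) (Var ''active''))
      (Seq (Assign ''i'' (Elem ''left'' (Sub (Var ''active'') (Lit 1))))
      (Seq (search (Conj (Conj (Neg (Less (Elem ''left'' (Var ''k'')) (Var ''i'')))
                               (Neg (Less (Var ''i'') (Elem ''left'' (Var ''k'')))))
                         (Neg (Less (Elem ''weight'' (Var ''k''))
                                    (Add (Elem ''dual'' (Var ''i''))
                                         (Elem ''dual'' (Elem ''right'' (Var ''k''))))))) ''edge'')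
      (Cond (Less (Lit 0) (Var ''edge''))
         assign_edge
         (Store ''dual'' (Var ''i'') (Sub (Elem ''dual'' (Var ''i'')) (Lit 1))))))
      Skip) ?s1 (progress a b x y z s)"
    proof (rule computes_Cond)
      assume "\<not> bval (Less (Lit 0) (Var ''active'')) ?s1"
      then have no: "\<not> ?Active l" if "l \<in> E" for l using v that by auto
      \<comment> \<open>A free left vertex that failed the test has profit at most 0, hence 0 since
        duals are nonnegative.\<close>
      have "settled ?d ?\<mu>"
        unfolding settled_def
      proof (intro ballI impI)
        fix k assume "k \<in> E" "?\<mu> (L k) = 0"
        then show "?d (L k) = 0" using no[of k] invariant_dual(1)[OF inv, of "L k"] by auto
      qed
      then show "computes B Skip ?s1 (progress a b x y z s)"
        using w inv by (intro computes_Skip) (simp add: progress_def weighted_def frame_def)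
    next
      assume "bval (Less (Lit 0) (Var ''active'')) ?s1"
      then obtain k where k: "k \<in> E" "?Active k" "v = k + 1" using v by (auto intro: that[of "v - 1"])
      have k0: "?\<mu> (L k) = 0" using invariant_mate_range(1)[OF inv, of "L k"] k by force
      let ?s2 = "s\<lparr>var := (var s)(''k'' := m, ''active'' := k + 1, ''i'' := L k)\<rparr>"
      let ?Tight = "\<lambda>l. L l = L k \<and> ?d (L k) + ?d (R l) \<le> arr s ''weight'' l"
      show "computes B (Seq (Assign ''i'' (Elem ''left'' (Sub (Var ''active'') (Lit 1))))
        (Seq (search (Conj (Conj (Neg (Less (Elem ''left'' (Var ''k'')) (Var ''i'')))
                               (Neg (Less (Var ''i'') (Elem ''left'' (Var ''k'')))))
                         (Neg (Less (Elem ''weight'' (Var ''k''))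
                                    (Add (Elem ''dual'' (Var ''i''))
                                         (Elem ''dual'' (Elem ''right'' (Var ''k''))))))) ''edge'')
        (Cond (Less (Lit 0) (Var ''edge''))
           assign_edge
           (Store ''dual'' (Var ''i'') (Sub (Elem ''dual'' (Var ''i'')) (Lit 1)))))) ?s1
        (progress a b x y z s)"
      proof (rule computes_Seq, rule computes_Assign, goal_cases)
        case 1
        then show ?case by (simp add: bounded_state_def)
      next
        case 2
        have s2: "?s1\<lparr>var := (var ?s1)(''i'' := aval (Elem ''left'' (Sub (Var ''active'') (Lit 1))) ?s1)\<rparr> = ?s2"
          using fr k by simp
        show ?case
          unfolding s2
        proof (rule computes_Seq, rule computes_search[where m = m and P = ?Tight])
          fix u
          let ?s3 = "?s2\<lparr>var := (var ?s2)(''k'' := m, ''edge'' := u)\<rparr>"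
          assume u: "u = 0 \<and> (\<forall>l\<in>E. \<not> ?Tight l) \<or> u - 1 \<in> E \<and> ?Tight (u - 1)"
          have w3: "weighted a b x y z ?s3" using w by (simp add: weighted_def frame_def)
          \<comment> \<open>The scans wrote scratch variables only, so progress may be measured from
            the state before the round.\<close>
          have progress3: "progress a b x y z ?s3 = progress a b x y z s"
            by (simp add: progress_def fun_eq_iff)
          show "computes B (Cond (Less (Lit 0) (Var ''edge'')) assign_edge
             (Store ''dual'' (Var ''i'') (Sub (Elem ''dual'' (Var ''i'')) (Lit 1)))) ?s3 (progress a b x y z s)"
          proof (rule computes_Cond)
            assume "bval (Less (Lit 0) (Var ''edge'')) ?s3"
            then have l: "u - 1 \<in> E" "?Tight (u - 1)" using u by auto
            have "computes B assign_edge ?s3 (progress a b x y z ?s3)"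
              by (rule computes_assign_edge[OF w3 ab, where l = "u - 1"])
                (use inv l wt k k0 in simp_all)
            then show "computes B assign_edge ?s3 (progress a b x y z s)" by (simp only: progress3)
          next
            assume "\<not> bval (Less (Lit 0) (Var ''edge'')) ?s3"
            then have no: "\<not> ?Tight l" if "l \<in> E" for l using u that by auto
            have loose: "weight a b l < ?d (L k) + ?d (R l)" if "l \<in> E" "L l = L k" for l
              using no[OF that(1)] wt[OF that(1)] that(2) by auto
            have pos: "0 < ?d (L k)" using k(2) by simp
            note new = invariant_lower[OF inv k(1) k0 pos loose]
            have unsettled: "\<not> settled ?d ?\<mu>" using k k0 pos unfolding settled_def by force
            show "computes B (Store ''dual'' (Var ''i'') (Sub (Elem ''dual'' (Var ''i'')) (Lit 1))) ?s3
              (progress a b x y z s)"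
            proof (rule computes_Store)
              assume "bounded_state B ?s3"
              then have "\<bar>?d (L k)\<bar> \<le> int B" by (simp add: bounded_state_def)
              then show "\<bar>aval (Sub (Elem ''dual'' (Var ''i'')) (Lit 1)) ?s3\<bar> \<le> int B"
                using pos by simp
            next
              show "progress a b x y z s (?s3\<lparr>arr := (arr ?s3)(''dual'' := (arr ?s3 ''dual'')
                 (aval (Var ''i'') ?s3 := aval (Sub (Elem ''dual'' (Var ''i'')) (Lit 1)) ?s3))\<rparr>)"
                using new unsettled w by (simp add: progress_def weighted_def frame_def)
            qed
          qed
        qed (use fr m_nonneg in \<open>auto simp: not_less\<close>)
      qed
    qed
  qed (use fr m_nonneg in auto)
qed

end

section \<open>Ranking the candidate contracts\<close>

context contract_instance
begin

definition improves :: "int \<Rightarrow> int \<Rightarrow> int \<Rightarrow> int \<Rightarrow> int \<Rightarrow> int \<Rightarrow> bool" where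
  "improves a b r x y z \<longleftrightarrow> (y - x) * z * b < (b - a) * r * y"

text \<open>\<open>z = 0\<close> covers the initial values, which belong to no contract that has been tried.\<close>

definition best_among :: "(int \<times> int) set \<Rightarrow> int \<Rightarrow> int \<Rightarrow> int \<Rightarrow> bool" where
  "best_among D x y z \<longleftrightarrow> 0 \<le> x \<and> x \<le> y \<and> 0 < y \<and> 0 \<le> z \<and> (z = 0 \<or> response_reward x y z) \<and>
     (\<forall>a b. (a, b) \<in> D \<longrightarrow> 0 \<le> b \<and> (\<exists>r. response_reward a b r \<and> \<not> improves a b r x y z))"

lemma response_reward_nonneg:
  assumes "response_reward a b r"
  shows "0 \<le> r"
proof -
  obtain K where "K \<subseteq> {0..<m}" "sum f K = r"
    using assms unfolding response_reward_def index_matching_def by blast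
  then show ?thesis using f_nonneg sum_nonneg[of K f] by fastforce
qed

lemma best_among_keep:
  assumes "best_among D x y z" "response_reward a b r" "0 \<le> b" "\<not> improves a b r x y z"
  shows "best_among (insert (a, b) D) x y z"
  using assms unfolding best_among_def insert_iff prod.inject by blast

text \<open>The old value is nonnegative, so an improvement forces a < b: the new fraction is a
  contract below 1 with positive denominator, and pairs with b = 0 never get stored.\<close>

lemma best_among_replace:
  assumes best: "best_among D x y z" and r: "response_reward a b r" and ab: "0 \<le> a" "0 \<le> b"
    and imp: "improves a b r x y z"
  shows "best_among (insert (a, b) D) a b r"
proof -
  have r0: "0 \<le> r" by (rule response_reward_nonneg[OF r])
  have y: "0 < y" "x \<le> y" "0 \<le> z" using best by (auto simp: best_among_def)
  have "0 \<le> (y - x) * z * b" using y ab by simp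
  then have "0 < (b - a) * (r * y)" using imp by (simp add: improves_def mult.assoc)
  moreover have "0 \<le> r * y" using r0 y by simp
  ultimately have lt: "0 < b - a" by (simp only: zero_less_mult_iff not_less) linarith
  have keep: "\<not> improves a' b' r' a b r" if "0 \<le> b'" "\<not> improves a' b' r' x y z" for a' b' r'
  proof -
    \<comment> \<open>Transitivity of the cross-multiplied order: both comparisons involve the old
      fraction; scaling one by b and the other by b' chains them, and the factor y > 0
      cancels.\<close>
    have "(b' - a') * r' * y * b \<le> (y - x) * z * b' * b"
      using that(2) ab by (intro mult_right_mono) (auto simp: improves_def)
    also have "\<dots> = (y - x) * z * b * b'" by (simp add: mult_ac)
    also have "\<dots> \<le> (b - a) * r * y * b'"
      using imp that(1) by (intro mult_right_mono) (auto simp: improves_def)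
    finally have "y * ((b' - a') * r' * b) \<le> y * ((b - a) * r * b')" by (simp add: mult_ac)
    then show ?thesis using y by (simp add: improves_def)
  qed
  have new: "\<not> improves a b r a b r" by (simp add: improves_def)
  show ?thesis
    unfolding best_among_def
  proof (intro conjI allI impI)
    show "0 \<le> a" "a \<le> b" "0 < b" "0 \<le> r" "r = 0 \<or> response_reward a b r" using ab lt r r0 by simp_all
    fix a' b' assume "(a', b') \<in> insert (a, b) D"
    then consider "a' = a" "b' = b" | "(a', b') \<in> D" by blast
    then have "0 \<le> b' \<and> (\<exists>r'. response_reward a' b' r' \<and> \<not> improves a' b' r' a b r)"
    proof cases
      case 1
      then show ?thesis using ab r new by blast
    next
      case 2
      then show ?thesis using best keep unfolding best_among_def by blast
    qed
    then show "0 \<le> b'" "\<exists>r'. response_reward a' b' r' \<and> \<not> improves a' b' r' a b r" by simp_all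
  qed
qed

end

section \<open>Executing the search over all candidates\<close>

context bounded_instance
begin

text \<open>While unsettled, the potential is at least the number of rounds made minus
  \<open>m * bound\<close>. Its maximum is at most \<open>m * (bound + 1)\<close>, so
  \<open>rounds\<close> many gains are impossible and the auction has settled by then.\<close>

lemma computes_auction:
  assumes w: "weighted a b x y z s" and ab: "0 \<le> a" "a < span" "0 \<le> b"
    and init: "\<And>k. 0 \<le> k \<Longrightarrow> k < m \<Longrightarrow> arr s ''dual'' (L k) = bound \<and> arr s ''dual'' (R k) = 0 \<and>
       arr s ''mate'' (L k) = 0 \<and> arr s ''mate'' (R k) = 0"
  shows "computes B (For ''t'' ''rounds'' auction_round) s (\<lambda>s'. frame a b x y z s' \<and>
    response_reward a b (sum f {k\<in>{0..<m}. arr s' ''mate'' (L k) = k + 1}))"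
proof -
  interpret auction m L R "weight a b" bound by (rule auction_weight[OF ab])
  let ?I = "\<lambda>i s. weighted a b x y z s \<and> var s ''t'' = i \<and> invariant (arr s ''dual'') (arr s ''mate'') \<and>
    (settled (arr s ''dual'') (arr s ''mate'') \<or> i - m * bound \<le> potential (arr s ''dual''))"
  show ?thesis
  proof (rule computes_For[where I = ?I and N = rounds])
    show "?I 0 (s\<lparr>var := (var s)(''t'' := 0)\<rparr>)"
      using invariant_init[of "arr s ''dual''" "arr s ''mate''"] init w
      by (simp add: weighted_def frame_def)
    show "0 \<le> rounds" using bound_less_rounds bound_nonneg by linarith
    show "var s ''t'' = i \<and> var s ''rounds'' = rounds" if "?I i s" for i s
      using that by (simp add: weighted_def frame_def)
    show "computes B auction_round s
        (\<lambda>s'. var s' ''t'' = i \<and> ?I (i + 1) (s'\<lparr>var := (var s')(''t'' := i + 1)\<rparr>))"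
      if I: "?I i s" for i s
    proof (rule computes_weaken[OF computes_auction_round[of a b x y z s]])
      fix s' assume "progress a b x y z s s'"
      then show "var s' ''t'' = i \<and> ?I (i + 1) (s'\<lparr>var := (var s')(''t'' := i + 1)\<rparr>)"
        using I by (auto simp: progress_def weighted_def frame_def)
    qed (use I ab in simp_all)
    fix s' assume I: "?I rounds s'"
    have "rounds = 2 * (m * bound) + 2 * m + 2 * bound + 2"
      by (simp add: rounds_def algebra_simps)
    then have "m * (bound + 1) < rounds - m * bound"
      using m_nonneg bound_nonneg by (simp add: distrib_left)
    then have "settled (arr s' ''dual'') (arr s' ''mate'')"
      using I potential_le[of "arr s' ''dual''" "arr s' ''mate''"] by linarith
    then have "response_reward a b (sum f {k\<in>{0..<m}. arr s' ''mate'' (L k) = k + 1})"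
      using I by (intro response_rewardI[OF ab]) simp_all
    then show "frame a b x y z s' \<and>
        response_reward a b (sum f {k\<in>{0..<m}. arr s' ''mate'' (L k) = k + 1})"
      using I by (simp only: weighted_def)
  qed
qed

lemma computes_compare_contract:
  assumes "frame a b x y z s" "var s ''gain'' = r"
  shows "computes B compare_contract s
    (\<lambda>s'. if improves a b r x y z then frame a b a b r s' else frame a b x y z s')"
  unfolding compare_contract_def
proof (intro computes_Cond computes_Seq computes_Assign_fresh computes_Skip, goal_cases)
  case (4 s1 s2 s3)
  then show ?case using assms by (simp add: frame_def improves_def)
next
  case 5
  then show ?case using assms by (simp add: frame_def improves_def)
qed (unfold aval.simps, (rule bounded_state_var, assumption)+)

lemma computes_try_contract:
  assumes "frame a b x y z s" "0 \<le> a" "a < span" "0 \<le> b" "b < span"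
  shows "computes B try_contract s (\<lambda>s'. \<exists>r. response_reward a b r \<and>
    (if improves a b r x y z then frame a b a b r s' else frame a b x y z s'))"
  unfolding try_contract_def
proof (rule computes_Seq, rule computes_weaken[OF computes_prepare[OF assms]])
  let ?Q = "\<lambda>s'. \<exists>r. response_reward a b r \<and>
    (if improves a b r x y z then frame a b a b r s' else frame a b x y z s')"
  fix s1 assume "weighted a b x y z s1 \<and>
    (\<forall>k. 0 \<le> k \<longrightarrow> k < m \<longrightarrow> arr s1 ''dual'' (L k) = bound \<and> arr s1 ''dual'' (R k) = 0 \<and>
       arr s1 ''mate'' (L k) = 0 \<and> arr s1 ''mate'' (R k) = 0)"
  then have auction: "computes B (For ''t'' ''rounds'' auction_round) s1 (\<lambda>s'. frame a b x y z s' \<and>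
      response_reward a b (sum f {k\<in>{0..<m}. arr s' ''mate'' (L k) = k + 1}))"
    by (intro computes_auction[OF _ assms(2-4)]) simp_all
  show "computes B (Seq (For ''t'' ''rounds'' auction_round)
      (Seq (accumulate matched_edge ''gain'') compare_contract)) s1 ?Q"
  proof (rule computes_Seq, rule computes_weaken[OF auction])
    fix s2 :: state
    let ?r = "sum f {k\<in>{0..<m}. arr s2 ''mate'' (L k) = k + 1}"
    let ?s3 = "s2\<lparr>var := (var s2)(''k'' := m, ''gain'' := ?r)\<rparr>"
    assume s2: "frame a b x y z s2 \<and> response_reward a b ?r"
    then have fr: "var s2 ''edges'' = m" "arr s2 ''left'' = L" "arr s2 ''reward'' = f"
      by (simp_all add: frame_def)
    show "computes B (Seq (accumulate matched_edge ''gain'') compare_contract) s2 ?Q"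
    proof (rule computes_Seq, rule computes_accumulate[where m = m and f = f and
          P = "\<lambda>k. arr s2 ''mate'' (L k) = k + 1"])
      show "sum f {0..<m} \<le> int B"
        using span_le reward_sum_nonneg by (simp add: span_def reward_sum_def)
      have "frame a b x y z ?s3" using s2 by (simp add: frame_def)
      then have "computes B compare_contract ?s3
          (\<lambda>s'. if improves a b ?r x y z then frame a b a b ?r s' else frame a b x y z s')"
        by (rule computes_compare_contract) simp
      then show "computes B compare_contract ?s3 ?Q"
        by (rule computes_weaken) (use s2 in blast)
    qed (use fr m_nonneg f_nonneg in \<open>auto simp: matched_edge_def\<close>)
  qed
qed

lemma computes_contract_program:
  assumes s: "var s ''edges'' = m" "var s ''numerator'' = 0" "var s ''value'' = 0"
    "arr s ''left'' = L" "arr s ''right'' = R" "arr s ''reward'' = f" "arr s ''cost'' = c"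
  shows "computes B contract_program s (\<lambda>s'.
    best_among ({0..<span} \<times> {0..<span}) (var s' ''numerator'') (var s' ''denominator'') (var s' ''value''))"
  unfolding contract_program_def
proof (rule computes_Seq, rule computes_accumulate[where m = m and f = f and P = "\<lambda>_. True"])
  show "sum f {0..<m} \<le> int B"
    using span_le reward_sum_nonneg by (simp add: span_def reward_sum_def)
  let ?s1 = "s\<lparr>var := (var s)(''k'' := m, ''total'' := sum f {k\<in>{0..<m}. True})\<rparr>"
  let ?loop = "For ''b'' ''span'' (For ''a'' ''span'' try_contract)"
  let ?Q = "\<lambda>s'. best_among ({0..<span} \<times> {0..<span})
    (var s' ''numerator'') (var s' ''denominator'') (var s' ''value'')"
  \<comment> \<open>The variables a and b are not initialized before the loops, so
    \<open>frame\<close> takes whatever they hold; 0, 1, 0 stands for the contract 0 / 1 with the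
    value 0 as a placeholder.\<close>
  have loop: "computes B ?loop s2 ?Q" if fr: "frame (var s2 ''a'') (var s2 ''b'') 0 1 0 s2" for s2
  proof (rule computes_For[where N = span and
      I = "\<lambda>i s. \<exists>a x y z. frame a i x y z s \<and> best_among ({0..<span} \<times> {0..<i}) x y z"])
    show "0 \<le> span" using reward_sum_nonneg by (simp add: span_def)
    show "\<exists>a x y z. frame a 0 x y z (s2\<lparr>var := (var s2)(''b'' := 0)\<rparr>) \<and>
        best_among ({0..<span} \<times> {0..<0}) x y z"
      using fr by (intro exI[of _ "var s2 ''a''"] exI[of _ 0] exI[of _ 1])
        (simp add: frame_def best_among_def)
    fix i s3 assume "\<exists>a x y z. frame a i x y z s3 \<and> best_among ({0..<span} \<times> {0..<i}) x y z"
    then show "var s3 ''b'' = i \<and> var s3 ''span'' = span" by (auto simp: frame_def)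
  next
    fix i s3 assume i: "0 \<le> i" "i < span"
      and "\<exists>a x y z. frame a i x y z s3 \<and> best_among ({0..<span} \<times> {0..<i}) x y z"
    then obtain a x y z where fr3: "frame a i x y z s3" "best_among ({0..<span} \<times> {0..<i}) x y z"
      by (elim exE conjE)
    \<comment> \<open>The pairs tried so far: all with denominator below i, and the first j
      numerators for the denominator i.\<close>
    let ?D = "\<lambda>j. {0..<span} \<times> {0..<i} \<union> {0..<j} \<times> {i}"
    show "computes B (For ''a'' ''span'' try_contract) s3 (\<lambda>s'. var s' ''b'' = i \<and>
      (\<exists>a x y z. frame a (i + 1) x y z (s'\<lparr>var := (var s')(''b'' := i + 1)\<rparr>) \<and>
         best_among ({0..<span} \<times> {0..<i + 1}) x y z))"
    proof (rule computes_For[where N = span and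
        I = "\<lambda>j s. \<exists>x y z. frame j i x y z s \<and> best_among (?D j) x y z"])
      show "0 \<le> span" using i by simp
      show "\<exists>x y z. frame 0 i x y z (s3\<lparr>var := (var s3)(''a'' := 0)\<rparr>) \<and> best_among (?D 0) x y z"
        using fr3 by (intro exI[of _ x] exI[of _ y] exI[of _ z]) (simp add: frame_def)
      fix j s4 assume "\<exists>x y z. frame j i x y z s4 \<and> best_among (?D j) x y z"
      then show "var s4 ''a'' = j \<and> var s4 ''span'' = span" by (auto simp: frame_def)
    next
      fix j s4 assume j: "0 \<le> j" "j < span"
        and "\<exists>x y z. frame j i x y z s4 \<and> best_among (?D j) x y z"
      then obtain x y z where fr4: "frame j i x y z s4" "best_among (?D j) x y z"
        by (elim exE conjE)
      have D: "?D (j + 1) = insert (j, i) (?D j)" using j(1) by auto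
      show "computes B try_contract s4 (\<lambda>s'. var s' ''a'' = j \<and>
         (\<exists>x y z. frame (j + 1) i x y z (s'\<lparr>var := (var s')(''a'' := j + 1)\<rparr>) \<and>
            best_among (?D (j + 1)) x y z))"
      proof (rule computes_weaken[OF computes_try_contract[OF fr4(1) j i]])
        fix s5 assume "\<exists>r. response_reward j i r \<and>
          (if improves j i r x y z then frame j i j i r s5 else frame j i x y z s5)"
        then obtain r where r: "response_reward j i r"
          "if improves j i r x y z then frame j i j i r s5 else frame j i x y z s5" by (elim exE conjE)
        have "\<exists>x y z. frame j i x y z s5 \<and> best_among (insert (j, i) (?D j)) x y z"
          using r(2) best_among_replace[OF fr4(2) r(1) j(1) i(1)] best_among_keep[OF fr4(2) r(1) i(1)]
          by (auto split: if_splits)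
        then obtain x' y' z' where "frame j i x' y' z' s5" "best_among (?D (j + 1)) x' y' z'"
          unfolding D by (elim exE conjE)
        then show "var s5 ''a'' = j \<and>
         (\<exists>x y z. frame (j + 1) i x y z (s5\<lparr>var := (var s5)(''a'' := j + 1)\<rparr>) \<and>
            best_among (?D (j + 1)) x y z)"
          by (intro conjI exI[of _ x'] exI[of _ y'] exI[of _ z']) (simp_all add: frame_def)
      qed
    next
      fix s6 assume "\<exists>x y z. frame span i x y z s6 \<and> best_among (?D span) x y z"
      then obtain x y z where fr6: "frame span i x y z s6" "best_among (?D span) x y z"
        by (elim exE conjE)
      have "?D span = {0..<span} \<times> {0..<i + 1}" using i(1) by auto
      then show "var s6 ''b'' = i \<and>
       (\<exists>a x y z. frame a (i + 1) x y z (s6\<lparr>var := (var s6)(''b'' := i + 1)\<rparr>) \<and>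
         best_among ({0..<span} \<times> {0..<i + 1}) x y z)"
        using fr6 by (intro conjI exI[of _ span] exI[of _ x] exI[of _ y] exI[of _ z]) (simp_all add: frame_def)
    qed
  next
    fix s7 assume "\<exists>a x y z. frame a span x y z s7 \<and> best_among ({0..<span} \<times> {0..<span}) x y z"
    then obtain a x y z where "frame a span x y z s7" "best_among ({0..<span} \<times> {0..<span}) x y z"
      by (elim exE conjE)
    then show "?Q s7" by (simp add: frame_def)
  qed
  have bounds: "0 \<le> span" "span \<le> int B" "0 \<le> bound" "bound \<le> int B" "0 \<le> rounds" "rounds \<le> int B"
    using span_le rounds_le bound_less_rounds bound_nonneg reward_sum_nonneg by (auto simp: span_def)
  have tot: "sum f {k\<in>{0..<m}. True} = reward_sum"
    by (simp only: simp_thms Collect_mem_eq reward_sum_def)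
  show "computes B (Seq (Assign ''span'' (Add (Var ''total'') (Lit 2)))
    (Seq (Assign ''bound'' (Mul (Add (Var ''edges'') (Lit 1))
            (Mul (Var ''span'') (Mul (Var ''span'') (Var ''span'')))))
    (Seq (Assign ''rounds'' (Mul (Lit 2) (Mul (Add (Var ''edges'') (Lit 1)) (Add (Var ''bound'') (Lit 1)))))
    (Seq (Assign ''denominator'' (Lit 1)) ?loop)))) ?s1 ?Q"
    unfolding tot
  proof (intro computes_Seq computes_Assign_fresh, goal_cases)
    case 1
    then show ?case using bounds by (simp add: span_def)
  next
    case (2 s2)
    have "aval (Mul (Add (Var ''edges'') (Lit 1))
            (Mul (Var ''span'') (Mul (Var ''span'') (Var ''span'')))) s2 = bound"
      using 2(1,2) s(1) by (simp add: bound_def span_def)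
    then show ?case using bounds by simp
  next
    case (3 s2 s3)
    have "aval (Mul (Lit 2) (Mul (Add (Var ''edges'') (Lit 1)) (Add (Var ''bound'') (Lit 1)))) s3 = rounds"
      using 3(1-4) s(1) by (simp add: rounds_def bound_def span_def)
    then show ?case using bounds by simp
  next
    case (4 s2 s3 s4)
    then show ?case using bounds reward_sum_nonneg by (simp add: span_def)
  next
    case (5 s2 s3 s4 s5)
    then show ?case
      using s by (intro loop) (simp add: frame_def rounds_def bound_def span_def)
  qed
qed (use s m_nonneg f_nonneg in auto)

end

section \<open>From index sets to matchings\<close>

locale edge_list =
  fixes V U :: "nat set" and A :: "(nat \<times> nat) set" and es :: "(nat \<times> nat) list"
    and f c :: "nat \<times> nat \<Rightarrow> nat" and F C :: nat
  assumes graph: "bipartite_graph V U A" and es: "distinct es" "set es = A"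
    and f_le: "max_entry A f \<le> F" and c_le: "max_entry A c \<le> C"
begin

abbreviation "m \<equiv> int (length es)"
abbreviation "L \<equiv> table (map fst es)"
abbreviation "R \<equiv> table (map snd es)"
abbreviation "edge k \<equiv> es ! nat k"

lemma table_map: "0 \<le> k \<Longrightarrow> k < m \<Longrightarrow> table (map g es) k = int (g (edge k))"
  by (simp add: table_def nat_less_iff)

lemma edge_in: "0 \<le> k \<Longrightarrow> k < m \<Longrightarrow> edge k \<in> A"
  using es(2) nth_mem[of "nat k" es] by (simp add: nat_less_iff)

lemma finite_A: "finite A"
  using es(2) by auto

lemma entry_le:
  assumes "e \<in> A"
  shows "f e \<le> F" "c e \<le> C"
proof -
  have "f e \<le> max_entry A f" "c e \<le> max_entry A c"
    unfolding max_entry_def using assms finite_A by (intro Max_ge; simp)+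
  then show "f e \<le> F" "c e \<le> C" using f_le c_le by simp_all
qed

sublocale contract_instance m L R "table (map f es)" "table (map c es)" "int C"
proof
  fix k l assume k: "0 \<le> k" "k < m" and l: "0 \<le> l" "l < m"
  have "fst (edge k) \<in> V" "snd (edge l) \<in> U"
    using edge_in[OF k] edge_in[OF l] graph by (auto simp: bipartite_graph_def)
  then show "L k \<noteq> R l" using graph k l by (auto simp: table_map bipartite_graph_def)
next
  fix k assume k: "0 \<le> k" "k < m"
  show "0 \<le> table (map f es) k" using k by (simp add: table_map)
  show "0 \<le> table (map c es) k \<and> table (map c es) k \<le> int C"
    using k entry_le(2)[OF edge_in[OF k]] by (simp add: table_map)
qed simp

lemma inj_edge: "inj_on edge {0..<m}"
proof (rule inj_onI)
  fix k l assume "k \<in> {0..<m}" "l \<in> {0..<m}" "edge k = edge l"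
  then have "nat k = nat l" using es(1) by (simp add: nth_eq_iff_index_eq nat_less_iff)
  then show "k = l" using \<open>k \<in> {0..<m}\<close> \<open>l \<in> {0..<m}\<close> by (simp add: eq_nat_nat_iff)
qed

lemma edge_surj: "edge ` {0..<m} = A"
proof
  show "edge ` {0..<m} \<subseteq> A" using edge_in by auto
  show "A \<subseteq> edge ` {0..<m}"
  proof
    fix e assume "e \<in> A"
    then obtain i where "i < length es" "e = es ! i" using es(2) by (metis in_set_conv_nth)
    then show "e \<in> edge ` {0..<m}" by (intro image_eqI[of _ _ "int i"]) simp_all
  qed
qed

lemma sum_edge:
  assumes "K \<subseteq> {0..<m}"
  shows "int (sum g (edge ` K)) = sum (table (map g es)) K"
proof -
  have "int (sum g (edge ` K)) = (\<Sum>k\<in>K. int (g (edge k)))"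
    using inj_on_subset[OF inj_edge assms] by (simp add: sum.reindex)
  also have "\<dots> = sum (table (map g es)) K"
    by (rule sum.cong) (use assms in \<open>auto simp: table_map\<close>)
  finally show ?thesis .
qed

lemma index_matching_iff:
  assumes K: "K \<subseteq> {0..<m}"
  shows "index_matching K \<longleftrightarrow> matching (edge ` K)"
proof -
  have in_K: "0 \<le> k \<and> k < m" if "k \<in> K" for k using K that by auto
  have cross: "fst (edge k) \<noteq> snd (edge l)" if "k \<in> K" "l \<in> K" for k l
  proof -
    have "fst (edge k) \<in> V" "snd (edge l) \<in> U"
      using edge_in[of k] edge_in[of l] in_K that graph by (auto simp: bipartite_graph_def)
    then show ?thesis using graph by (auto simp: bipartite_graph_def)
  qed
  have eq: "edge k = edge l \<longleftrightarrow> k = l" if "k \<in> K" "l \<in> K" for k l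
    using inj_on_eq_iff[OF inj_edge] K that by blast
  have LR: "L k = int (fst (edge k))" "R k = int (snd (edge k))" if "k \<in> K" for k
    using table_map in_K[OF that] by simp_all
  have "index_matching K \<longleftrightarrow> (\<forall>k\<in>K. \<forall>l\<in>K. k \<noteq> l \<longrightarrow>
      fst (edge k) \<noteq> fst (edge l) \<and> snd (edge k) \<noteq> snd (edge l))"
    using K LR by (auto simp: index_matching_def inj_on_def)
  also have "\<dots> \<longleftrightarrow> (\<forall>k\<in>K. \<forall>l\<in>K. k \<noteq> l \<longrightarrow>
      disjnt {fst (edge k), snd (edge k)} {fst (edge l), snd (edge l)})"
    using cross by (auto simp: disjnt_def)
  also have "\<dots> \<longleftrightarrow> matching (edge ` K)"
    unfolding matching_def pairwise_def using eq by auto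
  finally show ?thesis .
qed

lemma matchings_index: "matchings A = (\<lambda>K. edge ` K) ` Collect index_matching"
proof
  show "(\<lambda>K. edge ` K) ` Collect index_matching \<subseteq> matchings A"
  proof
    fix M assume "M \<in> (\<lambda>K. edge ` K) ` Collect index_matching"
    then obtain K where K: "index_matching K" "M = edge ` K" by blast
    then have "K \<subseteq> {0..<m}" by (simp add: index_matching_def)
    then show "M \<in> matchings A"
      using K index_matching_iff edge_surj by (auto simp: matchings_def)
  qed
  show "matchings A \<subseteq> (\<lambda>K. edge ` K) ` Collect index_matching"
  proof
    fix M assume M: "M \<in> matchings A"
    then have "M \<subseteq> edge ` {0..<m}" using edge_surj by (simp add: matchings_def)
    then obtain K where K: "K \<subseteq> {0..<m}" "M = edge ` K" by (rule subset_imageE)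
    then have "index_matching K" using M index_matching_iff[OF K(1)] by (simp add: matchings_def)
    then show "M \<in> (\<lambda>K. edge ` K) ` Collect index_matching" using K by blast
  qed
qed

lemma reward_sum_eq: "reward_sum = int (sum f A)"
  unfolding reward_sum_def using sum_edge[of "{0..<m}" f] edge_surj by simp

text \<open>The agent's utility is scaled by \<open>b * (reward_sum + 1)\<close> in the objective, which leaves room for the
  reward as a secondary criterion.\<close>

lemma lex_best_reward:
  assumes r: "response_reward (int a) (int b) r" and "0 < b" and M: "lex_best A f c (real a / real b) M"
  shows "r = int (sum f M)"
proof -
  \<comment> \<open>This is b times the agent's utility at a / b, hence an integer.\<close>
  define util where "util N = int a * int (sum f N) - int b * int (sum c N)" for N
  have util: "real b * (real a / real b * real (sum f N) - real (sum c N)) = of_int (util N)" for N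
    using \<open>0 < b\<close> by (simp add: util_def right_diff_distrib)
  have util_mono: "real a / real b * real (sum f N) - real (sum c N)
      \<le> real a / real b * real (sum f N') - real (sum c N') \<longleftrightarrow> util N \<le> util N'" for N N'
  proof -
    have "real a / real b * real (sum f N) - real (sum c N)
      \<le> real a / real b * real (sum f N') - real (sum c N') \<longleftrightarrow>
      real b * (real a / real b * real (sum f N) - real (sum c N))
      \<le> real b * (real a / real b * real (sum f N') - real (sum c N'))"
      using \<open>0 < b\<close> by (simp only: mult_le_cancel_left_pos of_nat_0_less_iff)
    then show ?thesis unfolding util by simp
  qed
  have obj: "sum (objective (int a) (int b)) K = util (edge ` K) * (reward_sum + 1) + int (sum f (edge ` K))"
    if "K \<subseteq> {0..<m}" for K
    unfolding objective_def[abs_def] util_def sum_edge[OF that]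
    by (simp add: sum.distrib sum_subtractf sum_distrib_left sum_distrib_right left_diff_distrib)
  obtain K where K: "index_matching K" "sum (table (map f es)) K = r"
    "\<And>K'. index_matching K' \<Longrightarrow> sum (objective (int a) (int b)) K' \<le> sum (objective (int a) (int b)) K"
    using r unfolding response_reward_def by blast
  have sub: "K' \<subseteq> {0..<m}" if "index_matching K'" for K' using that by (simp add: index_matching_def)
  have MA: "M \<in> matchings A" using M by (simp add: lex_best_def)
  then obtain K1 where K1: "index_matching K1" "M = edge ` K1" unfolding matchings_index by blast
  let ?N = "edge ` K"
  have N: "?N \<in> matchings A" unfolding matchings_index using K(1) by blast
  have r_eq: "r = int (sum f ?N)" using sum_edge[OF sub[OF K(1)], of f] K(2) by simp
  have le_sum: "int (sum f ?N) \<le> reward_sum"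
    unfolding reward_sum_eq of_nat_le_iff
    by (rule sum_mono2) (use N finite_A in \<open>auto simp: matchings_def\<close>)
  have main: "util M * (reward_sum + 1) + int (sum f M) \<le> util ?N * (reward_sum + 1) + int (sum f ?N)"
    using K(3)[OF K1(1)] obj[OF sub[OF K(1)]] obj[OF sub[OF K1(1)]] K1(2) by simp
  have NM: "util ?N \<le> util M" using M N util_mono unfolding lex_best_def of_nat_sum by blast
  have "util M \<le> util ?N"
  proof (rule ccontr)
    assume "\<not> util M \<le> util ?N"
    \<comment> \<open>A deficit in the integer \<open>util\<close> is at least one and costs
      \<open>reward_sum + 1\<close>, more than any reward can repay.\<close>
    then have "(util ?N + 1) * (reward_sum + 1) \<le> util M * (reward_sum + 1)"
      using reward_sum_nonneg by (intro mult_right_mono) auto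
    then have "util ?N * (reward_sum + 1) + (reward_sum + 1) \<le> util M * (reward_sum + 1)"
      by (simp add: distrib_right)
    then show False using main le_sum of_nat_0_le_iff[of "sum f M"] by linarith
  qed
  with NM have eq: "util M = util ?N" by simp
  then have "sum f M \<le> sum f ?N" using main by (simp del: of_nat_sum)
  moreover have "real (sum f ?N) \<le> real (sum f M)"
  proof -
    have "real a / real b * real (sum f ?N) - real (sum c ?N) = real a / real b * real (sum f M) - real (sum c M)"
      using util_mono[of ?N M] util_mono[of M ?N] eq by (intro order_antisym) simp_all
    then show ?thesis using M N unfolding lex_best_def of_nat_sum by blast
  qed
  ultimately show ?thesis using r_eq by (simp only: of_nat_le_iff order_antisym)
qed

text \<open>If the initial values were never replaced, z = 0 is only a lower bound for the reward at
  the contract returned; this is the direction that the comparison needs.\<close>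

lemma best_among_optimal:
  assumes best: "best_among ({0..<span} \<times> {0..<span}) x y z" and "tie_breaking \<tau>" "\<kappa> > 0"
  shows "optimal_contract \<tau> A (\<lambda>e. \<kappa> * real (f e)) (\<lambda>e. \<kappa> * real (c e)) (of_int x / of_int y)"
proof -
  define a b where "a = nat x" and "b = nat y"
  have xy: "x = int a" "y = int b" "0 < b" "a \<le> b" "0 \<le> z"
    using best by (auto simp: best_among_def a_def b_def)
  obtain M0 where M0: "lex_best A f c (real a / real b) M0" using lex_best_exists[OF finite_A] by blast
  have z: "z \<le> int (sum f M0)"
  proof (cases "z = 0")
    case False
    then have "response_reward (int a) (int b) z" using best xy(1,2) by (auto simp: best_among_def)
    from lex_best_reward[OF this xy(3) M0] show ?thesis by simp
  qed (simp only: of_nat_0_le_iff)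
  have "optimal_contract \<tau> A (\<lambda>e. \<kappa> * real (f e)) (\<lambda>e. \<kappa> * real (c e)) (real a / real b)"
  proof (rule optimal_contractI[OF finite_A order_refl assms(2,3) xy(3,4) M0])
    fix a' b' M assume ab: "1 \<le> b'" "b' \<le> sum f A + 1" "a' \<le> b'" and M: "lex_best A f c (real a' / real b') M"
    \<comment> \<open>With \<open>span\<close> equal to N + 2 the half-open ranges reach N +
      1.\<close>
    have "(int a', int b') \<in> {0..<span} \<times> {0..<span}"
      using ab by (simp add: span_def reward_sum_eq del: of_nat_sum)
    then obtain r where r: "response_reward (int a') (int b') r" "\<not> improves (int a') (int b') r x y z"
      using best unfolding best_among_def by blast
    have "r = int (sum f M)" using lex_best_reward[OF r(1) _ M] ab(1) by simp
    then have "(int b' - int a') * int (sum f M) * int b \<le> (int b - int a) * z * int b'"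
      using r(2) xy by (simp add: improves_def)
    also have "\<dots> \<le> (int b - int a) * int (sum f M0) * int b'"
      using z xy by (intro mult_right_mono mult_left_mono) auto
    finally have "real_of_int ((int b' - int a') * int (sum f M) * int b) \<le> real_of_int ((int b - int a) * int (sum f M0) * int b')"
      by (simp only: of_int_le_iff)
    then have "(real b' - real a') * real (sum f M) * real b \<le> (real b - real a) * real (sum f M0) * real b'"
      by simp
    then have "(real b' - real a') * real (sum f M) / real b' \<le> (real b - real a) * real (sum f M0) / real b"
      using ab(1) xy(3) by (subst frac_le_eq) (auto simp: field_simps)
    moreover have "1 - real a' / real b' = (real b' - real a') / real b'" "1 - real a / real b = (real b - real a) / real b"
      using ab(1) xy(3) by (simp_all add: diff_divide_distrib)
    ultimately show "(1 - real a' / real b') * real (sum f M) \<le> (1 - real a / real b) * real (sum f M0)"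
      by simp
  qed
  then show ?thesis using xy by simp
qed

end

section \<open>Polynomial bounds on the stored values\<close>

text \<open>A common bound X for n, \<open>m + 1\<close>, \<open>span\<close> and all input numbers:
  there are at most n^2 edges, so the rewards sum to at most n^2 p(n); the summand 2 is that of
  \<open>span\<close>.\<close>

definition size_polynomial :: "nat poly \<Rightarrow> nat poly" where
  "size_polynomial p = [:0, 0, 1:] * p + [:0, 0, 1:] + p + 2"

text \<open>\<open>bound\<close> is at most X^4, thus \<open>bound + 1\<close> at most 2 X^4 and
  \<open>rounds\<close> at most 2 X (2 X^4) = 4 X^5. The weights need only 2 X^4.\<close>

definition value_polynomial :: "nat poly \<Rightarrow> nat poly" where
  "value_polynomial p = 4 * size_polynomial p ^ 5"

lemma poly_size: "poly (size_polynomial p) n = n ^ 2 * poly p n + n ^ 2 + poly p n + 2"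
  by (simp add: size_polynomial_def power2_eq_square algebra_simps)

lemma poly_value: "poly (value_polynomial p) n = 4 * poly (size_polynomial p) n ^ 5"
  by (simp add: value_polynomial_def)

lemma poly_size_le_value: "poly (size_polynomial p) n \<le> poly (value_polynomial p) n"
  unfolding poly_value using self_le_power[of "poly (size_polynomial p) n" 5] by (simp add: poly_size)

context edge_list
begin

lemma length_le:
  assumes "V \<union> U = {..<n}"
  shows "length es \<le> n ^ 2"
proof -
  have "A \<subseteq> {..<n} \<times> {..<n}" using graph assms by (auto simp: bipartite_graph_def)
  then have "card A \<le> card ({..<n} \<times> {..<n})" by (intro card_mono) auto
  then show ?thesis using distinct_card[OF es(1)] es(2) by (simp add: power2_eq_square)
qed

lemma bounded_instance_value:
  assumes VU: "V \<union> U = {..<n}" and F: "F \<le> poly p n" and C: "C \<le> poly p n"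
  shows "bounded_instance m L R (table (map f es)) (table (map c es)) (int C) (poly (value_polynomial p) n)"
proof -
  define X where "X = int (poly (size_polynomial p) n)"
  have X: "X = int n ^ 2 * int (poly p n) + int n ^ 2 + int (poly p n) + 2"
    by (simp add: X_def poly_size)
  have B: "int (poly (value_polynomial p) n) = 4 * X ^ 5" by (simp add: X_def poly_value)
  have X2: "2 \<le> X" by (simp add: X)
  have len: "m \<le> int n ^ 2" using length_le[OF VU] by (simp flip: of_nat_power)
  have "0 \<le> int n ^ 2 * int (poly p n)" by simp
  then have m: "m + 1 \<le> X" unfolding X using len by linarith
  have "sum f A \<le> card A * F" using sum_bounded_above[of A f F] entry_le(1) by simp
  also have "\<dots> = length es * F" using distinct_card[OF es(1)] es(2) by simp
  also have "\<dots> \<le> n ^ 2 * poly p n" by (rule mult_mono[OF length_le[OF VU] F]) auto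
  finally have "int (sum f A) \<le> int (n ^ 2 * poly p n)" by (simp only: of_nat_le_iff)
  then have "int (sum f A) \<le> int n ^ 2 * int (poly p n)" by simp
  moreover have "0 \<le> int n ^ 2" by simp
  ultimately have span: "span \<le> X" unfolding span_def reward_sum_eq X by linarith
  have span0: "0 \<le> span" using reward_sum_nonneg by (simp add: span_def)
  have "int C \<le> int (poly p n)" using C by simp
  then have C': "int C \<le> X"
    using \<open>0 \<le> int n ^ 2\<close> \<open>0 \<le> int n ^ 2 * int (poly p n)\<close> unfolding X by linarith
  have cube: "span * (span * span) \<le> X * (X * X)"
    using span span0 by (intro mult_mono) auto
  have "bound \<le> X * (X * (X * X))"
    unfolding bound_def using m_nonneg m span0 X2 by (intro mult_mono[OF _ cube]) auto
  then have bd: "bound + 1 \<le> 2 * (X * (X * (X * X)))"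
    using one_le_power[of X 4] X2 by (simp add: numeral_eq_Suc)
  have "(m + 1) * (bound + 1) \<le> X * (2 * (X * (X * (X * X))))"
    using m bd X2 bound_nonneg by (intro mult_mono) auto
  then have rounds: "rounds \<le> 4 * X ^ 5"
    by (simp add: rounds_def numeral_eq_Suc)
  have pow: "X ^ k \<le> X ^ 5" if "k \<le> 5" for k using that X2 by (intro power_increasing) auto
  have "span * int C * span \<le> X * X * X"
    using span span0 C' X2 by (intro mult_mono) auto
  then have "(m + 1) * (span * (span * span) + span * int C * span) \<le> X * (X * (X * X) + X * X * X)"
    using m X2 span0 by (intro mult_mono[OF _ add_mono[OF cube]]) auto
  also have "\<dots> = 2 * X ^ 4" by (simp add: numeral_eq_Suc)
  also have "\<dots> \<le> 4 * X ^ 5" using pow[of 4] one_le_power[of X 5] X2 by linarith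
  finally have weights: "(m + 1) * (span * (span * span) + span * int C * span) \<le> 4 * X ^ 5" .
  have "span \<le> 4 * X ^ 5" using span pow[of 1] X2 by simp
  with rounds weights show ?thesis
    by unfold_locales (simp_all only: B)
qed

lemma bounded_input:
  assumes VU: "V \<union> U = {..<n}" and F: "F \<le> poly p n" and C: "C \<le> poly p n"
  shows "bounded_state (poly (value_polynomial p) n) (input_state n es f c)"
proof -
  let ?X = "poly (size_polynomial p) n"
  have table_le: "\<bar>table xs i\<bar> \<le> int ?X" if "\<And>x. x \<in> set xs \<Longrightarrow> x \<le> ?X" for xs i
    using that by (auto simp: table_def)
  have "n \<le> n ^ 2" by (simp add: power2_eq_square)
  then have n: "n \<le> ?X" by (simp add: poly_size)
  have "fst e \<le> ?X" "snd e \<le> ?X" "f e \<le> ?X" "c e \<le> ?X" if "e \<in> set es" for e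
  proof -
    have "e \<in> A" using that es(2) by simp
    then have "fst e \<in> V" "snd e \<in> U" using graph by (auto simp: bipartite_graph_def)
    then have "fst e < n" "snd e < n" using VU by auto
    then show "fst e \<le> ?X" "snd e \<le> ?X" using n by simp_all
    show "f e \<le> ?X" "c e \<le> ?X" using entry_le[OF \<open>e \<in> A\<close>] F C by (simp_all add: poly_size)
  qed
  then have tables: "\<bar>table (map fst es) i\<bar> \<le> int ?X" "\<bar>table (map snd es) i\<bar> \<le> int ?X"
    "\<bar>table (map f es) i\<bar> \<le> int ?X" "\<bar>table (map c es) i\<bar> \<le> int ?X" for i
    by (intro table_le; auto)+
  have "length es \<le> ?X" using length_le[OF VU] by (simp add: poly_size)
  then have "bounded_state ?X (input_state n es f c)"
    using tables n unfolding bounded_state_def input_state_def by simp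
  then show ?thesis
    unfolding bounded_state_def using poly_size_le_value[of p n] by (meson of_nat_mono order_trans)
qed

end

theorem corollary2:
  shows "\<exists>P. \<forall>p :: nat poly. \<exists>q :: nat poly.
    \<forall>(n :: nat) (V :: nat set) (U :: nat set) (A :: (nat \<times> nat) set)
      (f :: nat \<times> nat \<Rightarrow> nat) (c :: nat \<times> nat \<Rightarrow> nat) (es :: (nat \<times> nat) list).
      bipartite_graph V U A \<longrightarrow> V \<union> U = {..<n} \<longrightarrow> distinct es \<longrightarrow> set es = A \<longrightarrow>
      max_entry A f \<le> poly p n \<longrightarrow> max_entry A c \<le> poly p n \<longrightarrow>
      (\<exists>t s. exec P (input_state n es f c) t s \<and> t \<le> poly q n \<and>
        var s ''denominator'' > 0 \<and>
        (\<forall>\<tau> \<kappa>. tie_breaking \<tau> \<longrightarrow> \<kappa> > 0 \<longrightarrow>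
          optimal_contract \<tau> A (\<lambda>e. \<kappa> * real (f e)) (\<lambda>e. \<kappa> * real (c e)) (output_contract s)))"
proof (intro exI[of _ contract_program] allI)
  fix p :: "nat poly"
  show "\<exists>q :: nat poly.
    \<forall>(n :: nat) (V :: nat set) (U :: nat set) (A :: (nat \<times> nat) set)
      (f :: nat \<times> nat \<Rightarrow> nat) (c :: nat \<times> nat \<Rightarrow> nat) (es :: (nat \<times> nat) list).
      bipartite_graph V U A \<longrightarrow> V \<union> U = {..<n} \<longrightarrow> distinct es \<longrightarrow> set es = A \<longrightarrow>
      max_entry A f \<le> poly p n \<longrightarrow> max_entry A c \<le> poly p n \<longrightarrow>
      (\<exists>t s. exec contract_program (input_state n es f c) t s \<and> t \<le> poly q n \<and>
        var s ''denominator'' > 0 \<and>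
        (\<forall>\<tau> \<kappa>. tie_breaking \<tau> \<longrightarrow> \<kappa> > 0 \<longrightarrow>
          optimal_contract \<tau> A (\<lambda>e. \<kappa> * real (f e)) (\<lambda>e. \<kappa> * real (c e)) (output_contract s)))"
  \<comment> \<open>The program was fixed before p. The polynomial p enters only through the bound
    on stored values, at which the time polynomial of the program text is evaluated.\<close>
  proof (intro exI[of _ "pcompose (com_time contract_program) (value_polynomial p)"] allI impI)
    fix n V U A f c es
    assume inst: "bipartite_graph V U A" "V \<union> U = {..<n}" "distinct es" "set es = A"
      "max_entry A f \<le> poly p n" "max_entry A c \<le> poly p n"
    interpret edge_list V U A es f c "poly p n" "poly p n"
      using inst by unfold_locales simp_all
    let ?B = "poly (value_polynomial p) n"
    interpret bounded_instance m L R "table (map f es)" "table (map c es)" "int (poly p n)" ?B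
      by (rule bounded_instance_value[OF inst(2) order_refl order_refl])
    let ?s = "input_state n es f c"
    have "computes ?B contract_program ?s (\<lambda>s'. best_among ({0..<span} \<times> {0..<span})
        (var s' ''numerator'') (var s' ''denominator'') (var s' ''value''))"
      by (rule computes_contract_program) (simp_all add: input_state_def)
    then obtain t s where ts: "exec contract_program ?s t s" "t \<le> poly (com_time contract_program) ?B"
      "best_among ({0..<span} \<times> {0..<span}) (var s ''numerator'') (var s ''denominator'') (var s ''value'')"
      using bounded_input[OF inst(2) order_refl order_refl]
      unfolding computes_def by blast
    have "0 < var s ''denominator''" using ts(3) by (simp add: best_among_def)
    moreover have "optimal_contract \<tau> A (\<lambda>e. \<kappa> * real (f e)) (\<lambda>e. \<kappa> * real (c e)) (output_contract s)"
      if "tie_breaking \<tau>" "\<kappa> > 0" for \<tau> \<kappa>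
      unfolding output_contract_def by (rule best_among_optimal[OF ts(3) that])
    ultimately show "\<exists>t s. exec contract_program ?s t s \<and>
        t \<le> poly (pcompose (com_time contract_program) (value_polynomial p)) n \<and>
        var s ''denominator'' > 0 \<and>
        (\<forall>\<tau> \<kappa>. tie_breaking \<tau> \<longrightarrow> \<kappa> > 0 \<longrightarrow>
          optimal_contract \<tau> A (\<lambda>e. \<kappa> * real (f e)) (\<lambda>e. \<kappa> * real (c e)) (output_contract s))"
      using ts(1,2) by (auto simp: poly_pcompose)
  qed
qed

end
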